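(* A group can be realized as the group of a virtual link (that is, it is isomorphic to the group of some Gauss diagram) if and only if it has a Wirtinger presentation such that each connected component of the associated graph has Euler characteristic $0$ or $1$.
   Context: Gauss diagram: a union of finitely many (at least one) oriented circles, together with finitely many arrows connecting pairs of points on these circles (all endpoints distinct; both endpoints of an arrow may lie on the same circle), each arrow equipped with a sign $+$ or $-$; considered up to orientation preserving diffeomorphism respecting arrows and signs. Virtual links are represented by Gauss diagrams (arrows correspond to classical crossings, oriented from the over-branch to the under-branch and carrying the sign of the crossing), and every Gauss diagram represents a virtual link. Group of a Gauss diagram (and of the virtual link it represents): cut the circles at every arrowhead and forget all arrowtails, so that the circles split into arcs (a circle containing no arrowhead is counted as a single arc). The group has one generator for each arc and one defining relation for each arrow: if the arrow has sign $\varepsilon$, its tail lies on the arc $a$, and its head separates the arcs $b$ and $c$, with $c$ following $b$ in the direction of the circle's orientation, then the relation is $c=a^{-\varepsilon}\,b\,a^{\varepsilon}$. The group of a virtual link is the group of a Gauss diagram representing it. Wirtinger presentation: a finite presentation $\langle m_1,\dots,m_n\mid r_1,\dots,r_s\rangle$, $n\ge 1$, $n\ge s$, where each relator $r_q$ has the form $r_q=m_i^{-1}w_q^{-1}m_jw_q$ (i.e. the relation $m_i=w_q^{-1}m_jw_q$) for some $i,j\in\{1,\dots,n\}$ (depending on $q$) and some word $w_q$ in the generators and their inverses. Graph of a Wirtinger presentation: the unoriented graph (loops and multiple edges allowed) whose vertices are the generators $m_1,\dots,m_n$ and which has, for each relator $r_q=m_i^{-1}w_q^{-1}m_jw_q$,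 one edge connecting $m_i$ and $m_j$. The Euler characteristic of a connected graph is the number of vertices minus the number of edges. *)

theory Defs
  imports "HOL-Algebra.Group"
begin

section \<open>Group presentations\<close>

datatype sign = Pos | Neg

fun opp :: "sign \<Rightarrow> sign" where
  "opp Pos = Neg"
| "opp Neg = Pos"

text \<open>The letter \<open>(x, Pos)\<close> stands for the generator \<open>x\<close>, the letter \<open>(x, Neg)\<close> for its inverse.\<close>

type_synonym 'a word = "('a \<times> sign) list"

definition words :: "'a set \<Rightarrow> 'a word set" where
  "words X = lists (X \<times> UNIV)"

definition inv_word :: "'a word \<Rightarrow> 'a word" where
  "inv_word w = rev (map (\<lambda>(x, e). (x, opp e)) w)"

text \<open>The smallest congruence on the monoid of words over \<open>X\<close> that identifies \<open>x x\<inverse>\<close>,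
  \<open>x\<inverse> x\<close> and every relator in \<open>R\<close> with the empty word; its classes are the elements of the
  group \<open>\<langle>X | R\<rangle>\<close>.  It is only used for \<open>R \<subseteq> words X\<close>.\<close>

inductive word_eq :: "'a set \<Rightarrow> 'a word set \<Rightarrow> 'a word \<Rightarrow> 'a word \<Rightarrow> bool"
  for X :: "'a set" and R :: "'a word set" where
  refl: "w \<in> words X \<Longrightarrow> word_eq X R w w"
| sym: "word_eq X R u v \<Longrightarrow> word_eq X R v u"
| trans: "word_eq X R u v \<Longrightarrow> word_eq X R v w \<Longrightarrow> word_eq X R u w"
| cancel: "u \<in> words X \<Longrightarrow> v \<in> words X \<Longrightarrow> x \<in> X \<Longrightarrow>
    word_eq X R (u @ [(x, e), (x, opp e)] @ v) (u @ v)"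
| relator: "u \<in> words X \<Longrightarrow> v \<in> words X \<Longrightarrow> r \<in> R \<Longrightarrow> r \<in> words X \<Longrightarrow>
    word_eq X R (u @ r @ v) (u @ v)"

definition word_rel :: "'a set \<Rightarrow> 'a word set \<Rightarrow> ('a word \<times> 'a word) set" where
  "word_rel X R = {(u, v). word_eq X R u v}"

definition presented_group :: "'a set \<Rightarrow> 'a word set \<Rightarrow> 'a word set monoid" where
  "presented_group X R =
    \<lparr>carrier = words X // word_rel X R,
     monoid.mult = (\<lambda>A B. \<Union>u\<in>A. \<Union>v\<in>B. word_rel X R `` {u @ v}),
     one = word_rel X R `` {[]}\<rparr>"


section \<open>Gauss diagrams and their groups\<close>

text \<open>The arrows of a Gauss diagram are numbered \<open>0, \<dots>, k - 1\<close>, where \<open>k\<close> is the length of the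
  list of their signs.  Each oriented circle is represented by the list of the arrow endpoints
  on it, in the order in which they are met when the circle is traversed once from an arbitrary
  base point; the empty list is a circle without endpoints.  Neither the numbering nor the
  order of the circles nor the base points matter up to isomorphism of the group.\<close>

datatype endpoint = Tail nat | Head nat

record gauss_diagram =
  circles :: "endpoint list list"
  signs :: "sign list"

definition is_gauss_diagram :: "gauss_diagram \<Rightarrow> bool" where
  "is_gauss_diagram D \<longleftrightarrow>
     circles D \<noteq> [] \<and>
     distinct (concat (circles D)) \<and>
     set (concat (circles D)) = Tail ` {..<length (signs D)} \<union> Head ` {..<length (signs D)}"

text \<open>\<open>endpoint_at D i p e\<close>: the \<open>p\<close>-th point on the \<open>i\<close>-th circle is the endpoint \<open>e\<close>.\<close>

definition endpoint_at :: "gauss_diagram \<Rightarrow> nat \<Rightarrow> nat \<Rightarrow> endpoint \<Rightarrow> bool" where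
  "endpoint_at D i p e \<longleftrightarrow>
     i < length (circles D) \<and> p < length (circles D ! i) \<and> circles D ! i ! p = e"

text \<open>The endpoints divide the circles into segments.  The segment \<open>(i, p)\<close> is the one that ends
  in the \<open>p\<close>-th point of the \<open>i\<close>-th circle; a circle without endpoints is the single segment
  \<open>(i, 0)\<close>.\<close>

definition segments :: "gauss_diagram \<Rightarrow> (nat \<times> nat) set" where
  "segments D = {(i, p). i < length (circles D) \<and> p < max 1 (length (circles D ! i))}"

definition next_seg :: "gauss_diagram \<Rightarrow> nat \<times> nat \<Rightarrow> nat \<times> nat" where
  "next_seg D = (\<lambda>(i, p). (i, Suc p mod length (circles D ! i)))"

text \<open>Forgetting the arrowtails joins the two segments adjacent to each arrowtail; the
  arcs are the resulting classes of segments.\<close>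

definition tail_join :: "gauss_diagram \<Rightarrow> ((nat \<times> nat) \<times> (nat \<times> nat)) set" where
  "tail_join D = {((i, p), next_seg D (i, p)) | i p k. endpoint_at D i p (Tail k)}"

definition same_arc :: "gauss_diagram \<Rightarrow> ((nat \<times> nat) \<times> (nat \<times> nat)) set" where
  "same_arc D = (tail_join D \<union> (tail_join D)\<inverse>)\<^sup>*"

definition arcs :: "gauss_diagram \<Rightarrow> (nat \<times> nat) set set" where
  "arcs D = segments D // same_arc D"

definition arc_of :: "gauss_diagram \<Rightarrow> nat \<times> nat \<Rightarrow> (nat \<times> nat) set" where
  "arc_of D s = same_arc D `` {s}"

text \<open>The relation \<open>c = a\<^sup>-\<^sup>\<epsilon> b a\<^sup>\<epsilon>\<close> of an arrow is expressed by the relator \<open>c\<inverse> a\<^sup>-\<^sup>\<epsilon> b a\<^sup>\<epsilon>\<close>.\<close>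

definition gauss_relators :: "gauss_diagram \<Rightarrow> (nat \<times> nat) set word set" where
  "gauss_relators D =
    {[(c, Neg), (a, opp \<epsilon>), (b, Pos), (a, \<epsilon>)] | a b c \<epsilon> k i p j q.
       k < length (signs D) \<and> \<epsilon> = signs D ! k \<and>
       endpoint_at D i p (Tail k) \<and> a = arc_of D (i, p) \<and>
       endpoint_at D j q (Head k) \<and> b = arc_of D (j, q) \<and> c = arc_of D (next_seg D (j, q))}"

definition gauss_group :: "gauss_diagram \<Rightarrow> (nat \<times> nat) set word set monoid" where
  "gauss_group D = presented_group (arcs D) (gauss_relators D)"

definition virtual_link_group :: "('a, 'b) monoid_scheme \<Rightarrow> bool" where
  "virtual_link_group G \<longleftrightarrow> (\<exists>D. is_gauss_diagram D \<and> G \<cong> gauss_group D)"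


section \<open>Wirtinger presentations and their graphs\<close>

text \<open>A Wirtinger presentation with generators \<open>0, \<dots>, n - 1\<close> is given by \<open>n\<close> and a list of
  triples \<open>(i, w, j)\<close>, each of which stands for the relator \<open>m\<^sub>i\<inverse> w\<inverse> m\<^sub>j w\<close>.\<close>

type_synonym wirtinger = "nat \<times> (nat \<times> nat word \<times> nat) list"

fun is_wirtinger :: "wirtinger \<Rightarrow> bool" where
  "is_wirtinger (n, rs) \<longleftrightarrow>
     n \<ge> 1 \<and> n \<ge> length rs \<and>
     (\<forall>(i, w, j) \<in> set rs. i < n \<and> j < n \<and> w \<in> words {..<n})"

fun wirtinger_relator :: "nat \<times> nat word \<times> nat \<Rightarrow> nat word" where
  "wirtinger_relator (i, w, j) = [(i, Neg)] @ inv_word w @ [(j, Pos)] @ w"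

fun wirtinger_group :: "wirtinger \<Rightarrow> nat word set monoid" where
  "wirtinger_group (n, rs) = presented_group {..<n} (wirtinger_relator ` set rs)"

text \<open>Unoriented graphs with loops and multiple edges; \<open>ends e\<close> is the set of the one or two
  end vertices of the edge \<open>e\<close>.\<close>

record ('v, 'e) multigraph =
  vertices :: "'v set"
  edges :: "'e set"
  ends :: "'e \<Rightarrow> 'v set"

definition adjacency :: "('v, 'e) multigraph \<Rightarrow> ('v \<times> 'v) set" where
  "adjacency \<Gamma> = {(u, v). \<exists>e \<in> edges \<Gamma>. ends \<Gamma> e = {u, v}}"

text \<open>The connected components, each given by its set of vertices.\<close>

definition components :: "('v, 'e) multigraph \<Rightarrow> 'v set set" where
  "components \<Gamma> = vertices \<Gamma> // (adjacency \<Gamma>)\<^sup>*"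

definition subgraph_on :: "('v, 'e) multigraph \<Rightarrow> 'v set \<Rightarrow> ('v, 'e) multigraph" where
  "subgraph_on \<Gamma> C =
     \<lparr>vertices = vertices \<Gamma> \<inter> C, edges = {e \<in> edges \<Gamma>. ends \<Gamma> e \<subseteq> C}, ends = ends \<Gamma>\<rparr>"

definition euler_char :: "('v, 'e) multigraph \<Rightarrow> int" where
  "euler_char \<Gamma> = int (card (vertices \<Gamma>)) - int (card (edges \<Gamma>))"

text \<open>The edges are the positions in the list of relators, so that repeated relators
  give multiple edges.\<close>

fun wirtinger_graph :: "wirtinger \<Rightarrow> (nat, nat) multigraph" where
  "wirtinger_graph (n, rs) =
     \<lparr>vertices = {..<n},
      edges = {..<length rs},
      ends = (\<lambda>q. case rs ! q of (i, w, j) \<Rightarrow> {i, j})\<rparr>"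


section \<open>Presented groups are groups\<close>

lemma words_simps [simp]:
  "[] \<in> words X"
  "(x, e) # w \<in> words X \<longleftrightarrow> x \<in> X \<and> w \<in> words X"
  "u @ v \<in> words X \<longleftrightarrow> u \<in> words X \<and> v \<in> words X"
  by (auto simp: words_def)

lemma opp_opp [simp]: "opp (opp e) = e"
  by (cases e) auto

lemma inv_word_in_words: "w \<in> words X \<Longrightarrow> inv_word w \<in> words X"
  by (auto simp: inv_word_def words_def in_lists_conv_set)

lemma word_eq_in_words: "word_eq X R u v \<Longrightarrow> u \<in> words X \<and> v \<in> words X"
  by (induction rule: word_eq.induct) auto

lemma word_eq_append_left: "word_eq X R u v \<Longrightarrow> w \<in> words X \<Longrightarrow> word_eq X R (w @ u) (w @ v)"
proof (induction rule: word_eq.induct)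
  case (cancel u v x e)
  then show ?case using word_eq.cancel[of "w @ u" X v x R e] by simp
next
  case (relator u v r)
  then show ?case using word_eq.relator[of "w @ u" X v r R] by simp
qed (auto intro: word_eq.intros)

lemma word_eq_append_right: "word_eq X R u v \<Longrightarrow> w \<in> words X \<Longrightarrow> word_eq X R (u @ w) (v @ w)"
proof (induction rule: word_eq.induct)
  case (cancel u v x e)
  then show ?case using word_eq.cancel[of u X "v @ w" x R e] by simp
next
  case (relator u v r)
  then show ?case using word_eq.relator[of u X "v @ w" r R] by simp
qed (auto intro: word_eq.intros)

lemma word_eq_append:
  "word_eq X R u u' \<Longrightarrow> word_eq X R v v' \<Longrightarrow> word_eq X R (u @ v) (u' @ v')"
  by (meson word_eq.trans word_eq_append_left word_eq_append_right word_eq_in_words)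

lemma word_eq_inv_word_left: "w \<in> words X \<Longrightarrow> word_eq X R (inv_word w @ w) []"
proof (induction w)
  case Nil
  then show ?case by (simp add: inv_word_def word_eq.refl)
next
  case (Cons l w)
  obtain x e where l: "l = (x, e)" by (cases l)
  with Cons.prems have x: "x \<in> X" and w: "w \<in> words X" by auto
  have "word_eq X R (inv_word w @ [(x, opp e), (x, opp (opp e))] @ w) (inv_word w @ w)"
    using x w inv_word_in_words[OF w] by (intro word_eq.cancel) auto
  with Cons.IH[OF w] show ?case
    by (auto simp: l inv_word_def intro: word_eq.trans)
qed

lemma equiv_word_rel: "equiv (words X) (word_rel X R)"
  by (rule equivI)
    (auto simp: word_rel_def refl_on_def dest: word_eq_in_words intro: word_eq.intros
      intro!: symI transI)

lemma presented_group_mult: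
  assumes "u \<in> words X" "v \<in> words X"
  shows "monoid.mult (presented_group X R) (word_rel X R `` {u}) (word_rel X R `` {v})
    = word_rel X R `` {u @ v}"
proof -
  have eq: "word_rel X R `` {u' @ v'} = word_rel X R `` {u @ v}"
    if "u' \<in> word_rel X R `` {u}" "v' \<in> word_rel X R `` {v}" for u' v'
  proof -
    have "(u @ v, u' @ v') \<in> word_rel X R"
      using that word_eq_append[of X R u u' v v'] by (simp add: word_rel_def)
    then show ?thesis
      by (rule equiv_class_eq[OF equiv_word_rel, symmetric])
  qed
  have ne: "word_rel X R `` {u} \<noteq> {}" "word_rel X R `` {v} \<noteq> {}"
    using assms equiv_class_self[OF equiv_word_rel] by blast+
  show ?thesis
    using ne by (simp add: presented_group_def eq cong: SUP_cong_simp)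
qed

theorem group_presented_group: "group (presented_group X R)"
proof (rule groupI)
  let ?G = "presented_group X R" and ?c = "\<lambda>u. word_rel X R `` {u}"
  have carrier: "A \<in> carrier ?G \<longleftrightarrow> (\<exists>u \<in> words X. A = ?c u)" for A
    by (auto simp: presented_group_def quotient_def)
  have one: "one ?G = ?c []"
    by (simp add: presented_group_def)
  note mult = presented_group_mult
  show "one ?G \<in> carrier ?G"
    unfolding carrier one by (rule bexI[of _ "[]"]) auto
  fix A assume "A \<in> carrier ?G"
  then obtain u where u: "u \<in> words X" "A = ?c u" by (auto simp: carrier)
  show "monoid.mult ?G (one ?G) A = A"
    using u by (simp add: one mult)
  show "\<exists>B \<in> carrier ?G. monoid.mult ?G B A = one ?G"
  proof
    show "?c (inv_word u) \<in> carrier ?G"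
      using inv_word_in_words[OF u(1)] by (auto simp: carrier)
    show "monoid.mult ?G (?c (inv_word u)) A = one ?G"
    proof -
      have "(inv_word u @ u, []) \<in> word_rel X R"
        using word_eq_inv_word_left[OF u(1)] by (simp add: word_rel_def)
      then have "?c (inv_word u @ u) = ?c []"
        by (rule equiv_class_eq[OF equiv_word_rel])
      then show ?thesis
        using u inv_word_in_words[OF u(1)] by (simp add: one mult)
    qed
  qed
  fix B assume "B \<in> carrier ?G"
  then obtain v where v: "v \<in> words X" "B = ?c v" by (auto simp: carrier)
  show "monoid.mult ?G A B \<in> carrier ?G"
    unfolding carrier using u v by (intro bexI[of _ "u @ v"]) (auto simp: mult)
  fix C assume "C \<in> carrier ?G"
  then obtain w where w: "w \<in> words X" "C = ?c w" by (auto simp: carrier)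
  show "monoid.mult ?G (monoid.mult ?G A B) C = monoid.mult ?G A (monoid.mult ?G B C)"
    using u v w by (simp add: mult)
qed

end

theory Submission
  imports Defs
begin

text \<open>A circle of a Gauss diagram, cut at all arrow endpoints, is a cycle of conjugation relations
  between consecutive segments (a tail contributes an equality), or a single generator without
  relation; so its Euler characteristic is \<open>0\<close> or \<open>1\<close>.

  Conversely, a component of Euler characteristic \<open>0\<close> or \<open>1\<close> contains at most one independent
  cycle.  Along a spanning tree every generator is a conjugate \<open>v = W\<^sub>v\<inverse> r W\<^sub>v\<close> of a root \<open>r\<close>,
  and an additional edge says that some word \<open>S\<close> commutes with \<open>r\<close>.  These relations do not
  depend on the tree any more: for an arbitrary cyclic order of the generators they are equivalent
  to \<open>v' = (W\<^sub>v\<inverse> W\<^sub>v\<^sub>')\<inverse> v (W\<^sub>v\<inverse> W\<^sub>v\<^sub>')\<close> for consecutive \<open>v\<close>, \<open>v'\<close>, with \<open>S\<close> inserted in the middle of the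
  closing word (for a tree, where \<open>S\<close> is empty, the closing relation is redundant).  A circle
  realises such a cycle: each letter of a conjugating word becomes an arrowhead.\<close>

section \<open>Values of words in a group\<close>

text \<open>Isomorphisms are not built by rewriting words. A presentation is handled through its
  models, the assignments of group elements that satisfy the relations, and two presentations are
  isomorphic once fixed substitutions carry the models of each to models of the other
  (\<open>pres_isoI\<close>). Changing relations then means transforming equations in a group.

  In the converse direction the hypothesis is a count, whereas the construction needs a word. The
  star form carries both: it lists one loop word per independent cycle, and the Euler characteristic
  of a component is one minus the length of that list. A circle has a single closing word, which can
  express a single commutation with the root; this is where the values 0 and 1 enter.

  Conjugating words may be empty, as for an isolated generator. A cancelling pair is therefore
  appended to each of them: it changes no value, but it gives every generator an arrowhead, so that
  every block and every circle of the diagram is nonempty.\<close>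

primrec signed :: "('g, 'c) monoid_scheme \<Rightarrow> sign \<Rightarrow> 'g \<Rightarrow> 'g" where
  "signed G Pos g = g"
| "signed G Neg g = inv\<^bsub>G\<^esub> g"

primrec val :: "('g, 'c) monoid_scheme \<Rightarrow> ('x \<Rightarrow> 'g) \<Rightarrow> 'x word \<Rightarrow> 'g" where
  "val G f [] = \<one>\<^bsub>G\<^esub>"
| "val G f (l # w) = signed G (snd l) (f (fst l)) \<otimes>\<^bsub>G\<^esub> val G f w"

text \<open>This is a right action: a product acts by its left factor first. A word thus acts letter
  by letter from left to right, the order in which arrowheads are met along a circle.\<close>

definition conj_by :: "('g, 'c) monoid_scheme \<Rightarrow> 'g \<Rightarrow> 'g \<Rightarrow> 'g" where
  "conj_by G a x = inv\<^bsub>G\<^esub> a \<otimes>\<^bsub>G\<^esub> x \<otimes>\<^bsub>G\<^esub> a"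

lemma inv_word_simps [simp]:
  "inv_word [] = []"
  "inv_word (l # w) = inv_word w @ [(fst l, opp (snd l))]"
  by (auto simp: inv_word_def split: prod.split)

lemma inv_word_words [simp]: "inv_word w \<in> words X \<longleftrightarrow> w \<in> words X"
  by (induction w) auto

lemma words_Cons [simp]: "l # w \<in> words X \<longleftrightarrow> fst l \<in> X \<and> w \<in> words X"
  by (cases l) simp

lemma words_iff: "w \<in> words X \<longleftrightarrow> (\<forall>l \<in> set w. fst l \<in> X)"
  by (induction w) auto

context group
begin

lemma signed_closed [simp]: "g \<in> carrier G \<Longrightarrow> signed G e g \<in> carrier G"
  by (cases e) auto

lemma signed_opp [simp]: "g \<in> carrier G \<Longrightarrow> signed G (opp e) g = inv (signed G e g)"
  by (cases e) auto

lemma val_closed [simp]: "f \<in> X \<rightarrow> carrier G \<Longrightarrow> w \<in> words X \<Longrightarrow> val G f w \<in> carrier G"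
  by (induction w) (auto simp: Pi_iff)

lemma val_append [simp]:
  "f \<in> X \<rightarrow> carrier G \<Longrightarrow> u \<in> words X \<Longrightarrow> v \<in> words X \<Longrightarrow>
    val G f (u @ v) = val G f u \<otimes> val G f v"
  by (induction u) (auto simp: m_assoc Pi_iff)

lemma val_inv_word [simp]:
  "f \<in> X \<rightarrow> carrier G \<Longrightarrow> w \<in> words X \<Longrightarrow> val G f (inv_word w) = inv (val G f w)"
proof (induction w)
  case (Cons l w)
  then have "f (fst l) \<in> carrier G" by auto
  with Cons show ?case by (auto simp: inv_mult_group val_append[of f X])
qed auto

lemma conj_by_closed [simp]:
  "a \<in> carrier G \<Longrightarrow> x \<in> carrier G \<Longrightarrow> conj_by G a x \<in> carrier G"
  by (simp add: conj_by_def)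

lemma conj_by_one [simp]: "x \<in> carrier G \<Longrightarrow> conj_by G \<one> x = x"
  by (simp add: conj_by_def)

lemma conj_by_mult [simp]:
  "a \<in> carrier G \<Longrightarrow> b \<in> carrier G \<Longrightarrow> x \<in> carrier G \<Longrightarrow>
    conj_by G (a \<otimes> b) x = conj_by G b (conj_by G a x)"
  by (simp add: conj_by_def inv_mult_group m_assoc)

lemma conj_by_inv1 [simp]:
  "a \<in> carrier G \<Longrightarrow> x \<in> carrier G \<Longrightarrow> conj_by G a (conj_by G (inv a) x) = x"
  using conj_by_mult[of "inv a" a x] by simp

lemma conj_by_inv2 [simp]:
  "a \<in> carrier G \<Longrightarrow> x \<in> carrier G \<Longrightarrow> conj_by G (inv a) (conj_by G a x) = x"
  using conj_by_mult[of a "inv a" x] by simp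

lemma conj_by_inv_eq_iff:
  "a \<in> carrier G \<Longrightarrow> x \<in> carrier G \<Longrightarrow> y \<in> carrier G \<Longrightarrow>
    conj_by G (inv a) y = x \<longleftrightarrow> y = conj_by G a x"
  by auto

lemma val_conj_word:
  assumes "f \<in> X \<rightarrow> carrier G" "x \<in> X" "w \<in> words X"
  shows "val G f (inv_word w @ [(x, Pos)] @ w) = conj_by G (val G f w) (f x)"
proof -
  have "f x \<in> carrier G" "val G f w \<in> carrier G" using assms by auto
  then show ?thesis
    using assms by (simp add: val_append[of f X] val_inv_word[of f X] conj_by_def m_assoc)
qed

end


section \<open>Presentations by conjugation relations\<close>

text \<open>The triple \<open>(c, w, b)\<close> stands for the relation \<open>c = w\<inverse> b w\<close>.\<close>

type_synonym 'x conj_rel = "'x \<times> 'x word \<times> 'x"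

text \<open>One shape for both sides: a one-letter \<open>w\<close> gives the relator of an arrow,
  and over the natural numbers it is \<open>wirtinger_relator\<close>.\<close>

definition relator_of :: "'x conj_rel \<Rightarrow> 'x word" where
  "relator_of = (\<lambda>(c, w, b). [(c, Neg)] @ inv_word w @ [(b, Pos)] @ w)"

definition conj_rels :: "'x set \<Rightarrow> 'x conj_rel set" where
  "conj_rels X = X \<times> words X \<times> X"

definition pres :: "'x set \<Rightarrow> 'x conj_rel set \<Rightarrow> 'x word set monoid" where
  "pres X T = presented_group X (relator_of ` T)"

text \<open>For \<open>T\<close> within \<open>conj_rels X\<close> these are, by the universal
  property, the homomorphisms from \<open>pres X T\<close> to \<open>G\<close>, recorded by the
  images of the generators.\<close>

definition model :: "('g, 'c) monoid_scheme \<Rightarrow> 'x set \<Rightarrow> 'x conj_rel set \<Rightarrow> ('x \<Rightarrow> 'g) \<Rightarrow> bool" where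
  "model G X T f \<longleftrightarrow> f \<in> X \<rightarrow> carrier G \<and>
     (\<forall>(c, w, b) \<in> T. f c = conj_by G (val G f w) (f b))"

lemma conj_rels_iff [simp]: "(c, w, b) \<in> conj_rels X \<longleftrightarrow> c \<in> X \<and> w \<in> words X \<and> b \<in> X"
  by (auto simp: conj_rels_def)

lemma group_pres: "group (pres X T)"
  by (simp add: pres_def group_presented_group)

lemma (in group) val_relator_of:
  assumes "f \<in> X \<rightarrow> carrier G" "(c, w, b) \<in> conj_rels X"
  shows "val G f (relator_of (c, w, b)) = \<one> \<longleftrightarrow> f c = conj_by G (val G f w) (f b)"
proof -
  have c: "f c \<in> carrier G" "f b \<in> carrier G" "val G f w \<in> carrier G" using assms by auto
  have "val G f (relator_of (c, w, b)) = inv (f c) \<otimes> conj_by G (val G f w) (f b)"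
    using val_conj_word[OF assms(1), of b w] assms by (simp add: relator_of_def)
  then show ?thesis
    using c by (metis conj_by_closed inv_closed inv_equality inv_inv l_inv)
qed

lemma relator_of_words: "t \<in> conj_rels X \<Longrightarrow> relator_of t \<in> words X"
  by (cases t) (auto simp: relator_of_def)

text \<open>Cancelling pairs and relators evaluate to one in a model. Hence the value of a word
  depends only on its class, which lets \<open>extend\<close> evaluate any representative.\<close>

lemma (in group) word_eq_sound:
  assumes "model G X T f" "T \<subseteq> conj_rels X" "word_eq X (relator_of ` T) u v"
  shows "val G f u = val G f v"
  using assms(3)
proof (induction rule: word_eq.induct)
  have f: "f \<in> X \<rightarrow> carrier G" using assms(1) by (simp add: model_def)
  {
    case (cancel u v x e)
    then have x: "f x \<in> carrier G" using f by auto
    have "val G f ([(x, e), (x, opp e)] @ v) = val G f v"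
      using x val_closed[OF f cancel(2)] by (simp add: m_assoc[symmetric])
    then show ?case
      using cancel f by (simp add: val_append[of f X])
  next
    case (relator u v r)
    then obtain t where t: "t \<in> T" "r = relator_of t" by auto
    obtain c w b where [simp]: "t = (c, w, b)" by (cases t)
    have "val G f r = \<one>"
      using t assms(1,2) val_relator_of[OF f, of c w b] by (force simp: model_def)
    then show ?case
      using relator f by (simp add: val_append[of f X])
  }
qed auto

section \<open>The presented group as the universal model\<close>

definition gen :: "'x set \<Rightarrow> 'x conj_rel set \<Rightarrow> 'x \<Rightarrow> 'x word set" where
  "gen X T x = word_rel X (relator_of ` T) `` {[(x, Pos)]}"

lemma word_class_eq:
  "word_eq X R u v \<Longrightarrow> word_rel X R `` {u} = word_rel X R `` {v}"
  by (rule equiv_class_eq[OF equiv_word_rel]) (simp add: word_rel_def)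

lemma carrier_pres_iff:
  "A \<in> carrier (pres X T) \<longleftrightarrow> (\<exists>w \<in> words X. A = word_rel X (relator_of ` T) `` {w})"
  by (auto simp: pres_def presented_group_def quotient_def)

text \<open>Both sides are multiplicative, so single letters decide; for an inverse letter,
  cancellation shows that its class is a left inverse of the generator. Computations with classes
  thereby become evaluations.\<close>

lemma val_gen:
  assumes "w \<in> words X"
  shows "val (pres X T) (gen X T) w = word_rel X (relator_of ` T) `` {w}"
  using assms
proof (induction w)
  case Nil
  then show ?case by (simp add: pres_def presented_group_def)
next
  case (Cons l w)
  let ?R = "relator_of ` T"
  obtain x e where [simp]: "l = (x, e)" by (cases l)
  have x: "x \<in> X" using Cons by simp
  have "word_rel X ?R `` {[(x, Neg)]} \<otimes>\<^bsub>pres X T\<^esub> gen X T x = \<one>\<^bsub>pres X T\<^esub>"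
    unfolding gen_def pres_def using x word_eq.cancel[of "[]" X "[]" x ?R Neg]
    by (subst presented_group_mult) (auto simp: presented_group_def word_class_eq)
  then have "inv\<^bsub>pres X T\<^esub> gen X T x = word_rel X ?R `` {[(x, Neg)]}"
    using x by (intro group.inv_equality[OF group_pres]) (auto simp: carrier_pres_iff gen_def)
  then have "signed (pres X T) e (gen X T x) = word_rel X ?R `` {[(x, e)]}"
    by (cases e) (auto simp: gen_def)
  then show ?case
    using Cons x presented_group_mult[of "[(x, e)]" X w ?R] by (auto simp: pres_def)
qed

lemma gen_closed: "gen X T \<in> X \<rightarrow> carrier (pres X T)"
  by (auto simp: carrier_pres_iff gen_def intro!: bexI[of _ "[(_, Pos)]"])

lemma carrier_presE:
  assumes "A \<in> carrier (pres X T)"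
  obtains w where "w \<in> words X" "A = val (pres X T) (gen X T) w"
  using assms by (auto simp: carrier_pres_iff val_gen)

lemma model_gen:
  assumes "T \<subseteq> conj_rels X"
  shows "model (pres X T) X T (gen X T)"
proof -
  interpret group "pres X T" by (rule group_pres)
  show ?thesis
    unfolding model_def
  proof (intro conjI gen_closed ballI, clarify)
    fix c w b assume t: "(c, w, b) \<in> T"
    let ?r = "relator_of (c, w, b)"
    have r: "?r \<in> words X" using relator_of_words assms t by blast
    then have "word_eq X (relator_of ` T) ?r []"
      using word_eq.relator[of "[]" X "[]" ?r "relator_of ` T"] t by simp
    then have "val (pres X T) (gen X T) ?r = val (pres X T) (gen X T) []"
      using r word_class_eq by (simp only: val_gen words_simps)
    then show "gen X T c = conj_by (pres X T) (val (pres X T) (gen X T) w) (gen X T b)"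
      using val_relator_of[OF gen_closed, of c w b] assms t by auto
  qed
qed

text \<open>A model \<open>f\<close> of the relations extends to the homomorphism that sends the class of a word
  to its value under \<open>f\<close>.\<close>

definition extend :: "('g, 'c) monoid_scheme \<Rightarrow> 'x set \<Rightarrow> ('x \<Rightarrow> 'g) \<Rightarrow> 'x word set \<Rightarrow> 'g" where
  "extend G X f A = val G f (SOME w. w \<in> A)"

lemma (in group) extend_val:
  assumes "model G X T f" "T \<subseteq> conj_rels X" "w \<in> words X"
  shows "extend G X f (val (pres X T) (gen X T) w) = val G f w"
proof -
  let ?A = "word_rel X (relator_of ` T) `` {w}"
  have "w \<in> ?A"
    using equiv_class_self[OF equiv_word_rel] assms(3) .
  then have "(SOME w. w \<in> ?A) \<in> ?A" by (rule someI)
  then have "word_eq X (relator_of ` T) w (SOME w. w \<in> ?A)" by (auto simp: word_rel_def)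
  then show ?thesis
    using word_eq_sound[OF assms(1,2)] by (auto simp: extend_def val_gen assms(3))
qed

lemma (in group) extend_hom:
  assumes "model G X T f" "T \<subseteq> conj_rels X"
  shows "extend G X f \<in> hom (pres X T) G"
proof (rule homI)
  interpret P: group "pres X T" by (rule group_pres)
  have f: "f \<in> X \<rightarrow> carrier G" using assms(1) by (simp add: model_def)
  fix A assume "A \<in> carrier (pres X T)"
  then obtain u where u: "u \<in> words X" "A = val (pres X T) (gen X T) u"
    by (rule carrier_presE)
  show "extend G X f A \<in> carrier G"
    using u f extend_val[OF assms] by simp
  fix B assume "B \<in> carrier (pres X T)"
  then obtain v where v: "v \<in> words X" "B = val (pres X T) (gen X T) v"
    by (rule carrier_presE)
  have "A \<otimes>\<^bsub>pres X T\<^esub> B = val (pres X T) (gen X T) (u @ v)"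
    using u v by (simp add: P.val_append[OF gen_closed])
  then show "extend G X f (A \<otimes>\<^bsub>pres X T\<^esub> B) = extend G X f A \<otimes> extend G X f B"
    using u v f by (simp add: extend_val[OF assms] val_append[of f X])
qed

lemma val_hom:
  assumes "group G" "group H" "h \<in> hom G H" "f \<in> X \<rightarrow> carrier G" "w \<in> words X"
  shows "h (val G f w) = val H (\<lambda>x. h (f x)) w"
  using assms(5)
proof (induction w)
  interpret group_hom G H h
    using assms by (simp add: group_hom_def group_hom_axioms_def)
  {
    case Nil
    then show ?case by simp
  next
    case (Cons l w)
    then have c: "f (fst l) \<in> carrier G" "val G f w \<in> carrier G" using assms by auto
    have "h (signed G e (f (fst l))) = signed H e (h (f (fst l)))" for e
      using c by (cases e) auto
    then show ?case using Cons c by simp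
  }
qed

lemma val_cong: "(\<And>x. x \<in> X \<Longrightarrow> f x = g x) \<Longrightarrow> w \<in> words X \<Longrightarrow> val G f w = val G g w"
  by (induction w) auto

section \<open>Isomorphism criteria in terms of models\<close>

text \<open>Each presented group, with its own generators as model, is fed into the correspondence;
  the resulting models extend to mutually inverse homomorphisms. \<open>XY\<close> is applied only
  to \<open>pres X T\<close> and \<open>YX\<close> only to \<open>pres Y S\<close>, which fixes the
  types of \<open>G\<close>.\<close>

lemma pres_isoI:
  fixes \<phi> :: "'x \<Rightarrow> 'y word" and \<psi> :: "'y \<Rightarrow> 'x word"
  assumes T: "T \<subseteq> conj_rels X" and S: "S \<subseteq> conj_rels Y"
    and \<phi>: "\<And>x. x \<in> X \<Longrightarrow> \<phi> x \<in> words Y" and \<psi>: "\<And>y. y \<in> Y \<Longrightarrow> \<psi> y \<in> words X"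
    and XY: "\<And>(G :: 'x word set monoid) f. group G \<Longrightarrow> model G X T f \<Longrightarrow>
      model G Y S (\<lambda>y. val G f (\<psi> y)) \<and> (\<forall>x \<in> X. val G (\<lambda>y. val G f (\<psi> y)) (\<phi> x) = f x)"
    and YX: "\<And>(G :: 'y word set monoid) f. group G \<Longrightarrow> model G Y S f \<Longrightarrow>
      model G X T (\<lambda>x. val G f (\<phi> x)) \<and> (\<forall>y \<in> Y. val G (\<lambda>x. val G f (\<phi> x)) (\<psi> y) = f y)"
  shows "pres X T \<cong> pres Y S"
proof -
  let ?P = "pres X T" and ?Q = "pres Y S"
  define f where "f x = val ?Q (gen Y S) (\<phi> x)" for x
  define g where "g y = val ?P (gen X T) (\<psi> y)" for y
  interpret P: group ?P by (rule group_pres)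
  interpret Q: group ?Q by (rule group_pres)
  have f: "model ?Q X T f" "\<And>y. y \<in> Y \<Longrightarrow> val ?Q f (\<psi> y) = gen Y S y"
    using YX[OF group_pres model_gen[OF S]] by (auto simp: f_def[abs_def])
  have g: "model ?P Y S g" "\<And>x. x \<in> X \<Longrightarrow> val ?P g (\<phi> x) = gen X T x"
    using XY[OF group_pres model_gen[OF T]] by (auto simp: g_def[abs_def])
  have fc: "f \<in> X \<rightarrow> carrier ?Q" and gc: "g \<in> Y \<rightarrow> carrier ?P"
    using f g by (auto simp: model_def)
  let ?h = "extend ?Q X f" and ?k = "extend ?P Y g"
  have h: "?h \<in> hom ?P ?Q" using Q.extend_hom[OF f(1) T] .
  have k: "?k \<in> hom ?Q ?P" using P.extend_hom[OF g(1) S] .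
  \<comment> \<open>A homomorphism is determined by the images of the generators, and by
    \<open>g(2)\<close> the composite returns every generator.\<close>
  have kh: "?k (?h A) = A" if "A \<in> carrier ?P" for A
  proof -
    obtain u where u: "u \<in> words X" "A = val ?P (gen X T) u"
      using \<open>A \<in> carrier ?P\<close> by (rule carrier_presE)
    have "?k (f x) = gen X T x" if "x \<in> X" for x
      unfolding f_def using P.extend_val[OF g(1) S \<phi>] g(2) that by simp
    then have "val ?P (\<lambda>x. ?k (f x)) u = val ?P (gen X T) u"
      using u(1) by (intro val_cong[of X]) auto
    then show ?thesis
      using u Q.extend_val[OF f(1) T u(1)] val_hom[OF group_pres group_pres k fc u(1)] by simp
  qed
  have hk: "?h (?k A) = A" if "A \<in> carrier ?Q" for A
  proof -
    obtain u where u: "u \<in> words Y" "A = val ?Q (gen Y S) u"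
      using \<open>A \<in> carrier ?Q\<close> by (rule carrier_presE)
    have "?h (g y) = gen Y S y" if "y \<in> Y" for y
      unfolding g_def using Q.extend_val[OF f(1) T \<psi>] f(2) that by simp
    then have "val ?Q (\<lambda>y. ?h (g y)) u = val ?Q (gen Y S) u"
      using u(1) by (intro val_cong[of Y]) auto
    then show ?thesis
      using u P.extend_val[OF g(1) S u(1)] val_hom[OF group_pres group_pres h gc u(1)] by simp
  qed
  have "bij_betw ?h (carrier ?P) (carrier ?Q)"
    by (rule bij_betw_byWitness[of _ ?k])
      (use kh hk hom_in_carrier[OF h] hom_in_carrier[OF k] in auto)
  then show ?thesis
    using h by (auto simp: is_iso_def iso_def)
qed

lemma (in group) val_single [simp]: "f x \<in> carrier G \<Longrightarrow> val G f [(x, Pos)] = f x"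
  by simp

lemma model_cong:
  assumes "T \<subseteq> conj_rels X" "\<And>x. x \<in> X \<Longrightarrow> f x = g x" "model G X T f"
  shows "model G X T g"
  unfolding model_def
proof (intro conjI ballI, safe)
  show "g x \<in> carrier G" if "x \<in> X" for x
    using assms(2)[OF that] assms(3) that by (auto simp: model_def Pi_iff)
  fix c w b assume t: "(c, w, b) \<in> T"
  then have X: "c \<in> X" "w \<in> words X" "b \<in> X" using assms(1) by auto
  have "f c = conj_by G (val G f w) (f b)"
    using t assms(3) by (auto simp: model_def)
  then show "g c = conj_by G (val G g w) (g b)"
    using X assms(2) val_cong[of X f g w G] by simp
qed

text \<open>A one-letter word evaluates to \<open>f x\<close> times one, which is \<open>f x\<close>
  only inside the carrier, hence only for generators; \<open>model_cong\<close> replaces one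
  assignment by the other there.\<close>

lemma pres_isoI_letters:
  fixes X :: "'x set" and Y :: "'y set"
  assumes T: "T \<subseteq> conj_rels X" and S: "S \<subseteq> conj_rels Y"
    and \<phi>: "\<And>x. x \<in> X \<Longrightarrow> \<phi> x \<in> Y" and \<psi>: "\<And>y. y \<in> Y \<Longrightarrow> \<psi> y \<in> X"
    and XY: "\<And>(G :: 'x word set monoid) f. group G \<Longrightarrow> model G X T f \<Longrightarrow>
      model G Y S (\<lambda>y. f (\<psi> y)) \<and> (\<forall>x \<in> X. f (\<psi> (\<phi> x)) = f x)"
    and YX: "\<And>(G :: 'y word set monoid) f. group G \<Longrightarrow> model G Y S f \<Longrightarrow>
      model G X T (\<lambda>x. f (\<phi> x)) \<and> (\<forall>y \<in> Y. f (\<phi> (\<psi> y)) = f y)"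
  shows "pres X T \<cong> pres Y S"
proof (rule pres_isoI[where \<phi> = "\<lambda>x. [(\<phi> x, Pos)]" and \<psi> = "\<lambda>y. [(\<psi> y, Pos)]", OF T S])
  fix G :: "'x word set monoid" and f
  assume G: "group G" and f: "model G X T f"
  then have "f x \<in> carrier G" if "x \<in> X" for x using that by (auto simp: model_def)
  then have v: "f (\<psi> y) = val G f [(\<psi> y, Pos)]" if "y \<in> Y" for y
    using group.val_single[OF G, of f "\<psi> y"] \<psi> that by simp
  have c: "f (\<psi> (\<phi> x)) \<in> carrier G" if "x \<in> X" for x
    using \<phi> \<psi> that f by (auto simp: model_def Pi_iff)
  have "val G (\<lambda>y. val G f [(\<psi> y, Pos)]) [(\<phi> x, Pos)] = f x" if "x \<in> X" for x
    using group.val_single[OF G, of "\<lambda>y. val G f [(\<psi> y, Pos)]" "\<phi> x"] v[OF \<phi>[OF that], symmetric]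
      c[OF that] XY[OF G f] that by simp
  then show "model G Y S (\<lambda>y. val G f [(\<psi> y, Pos)]) \<and>
      (\<forall>x\<in>X. val G (\<lambda>y. val G f [(\<psi> y, Pos)]) [(\<phi> x, Pos)] = f x)"
    using model_cong[of S Y "\<lambda>y. f (\<psi> y)" _ G, OF S v] XY[OF G f] by blast
next
  fix G :: "'y word set monoid" and f
  assume G: "group G" and f: "model G Y S f"
  then have "f y \<in> carrier G" if "y \<in> Y" for y using that by (auto simp: model_def)
  then have v: "f (\<phi> x) = val G f [(\<phi> x, Pos)]" if "x \<in> X" for x
    using group.val_single[OF G, of f "\<phi> x"] \<phi> that by simp
  have c: "f (\<phi> (\<psi> y)) \<in> carrier G" if "y \<in> Y" for y
    using \<phi> \<psi> that f by (auto simp: model_def Pi_iff)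
  have "val G (\<lambda>x. val G f [(\<phi> x, Pos)]) [(\<psi> y, Pos)] = f y" if "y \<in> Y" for y
    using group.val_single[OF G, of "\<lambda>x. val G f [(\<phi> x, Pos)]" "\<psi> y"] v[OF \<psi>[OF that], symmetric]
      c[OF that] YX[OF G f] that by simp
  then show "model G X T (\<lambda>x. val G f [(\<phi> x, Pos)]) \<and>
      (\<forall>y\<in>Y. val G (\<lambda>x. val G f [(\<phi> x, Pos)]) [(\<psi> y, Pos)] = f y)"
    using model_cong[of T X "\<lambda>x. f (\<phi> x)" _ G, OF T v] YX[OF G f] by blast
qed (use \<phi> \<psi> in auto)

text \<open>Relations with the same models generate the same normal subgroup. This lets the
  relations of a Wirtinger presentation be exchanged for equivalent equations while the generators
  stay fixed.\<close>

lemma pres_cong: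
  fixes X :: "'x set"
  assumes "T \<subseteq> conj_rels X" "S \<subseteq> conj_rels X"
    and "\<And>(G :: 'x word set monoid) f. group G \<Longrightarrow> f \<in> X \<rightarrow> carrier G \<Longrightarrow>
      model G X T f \<longleftrightarrow> model G X S f"
  shows "pres X T \<cong> pres X S"
proof (rule pres_isoI_letters[OF assms(1,2), where \<phi> = "\<lambda>x. x" and \<psi> = "\<lambda>x. x"])
  have f: "f \<in> X \<rightarrow> carrier G" if "model G X S' f" for G :: "'x word set monoid" and f S'
    using that by (simp add: model_def)
  fix G :: "'x word set monoid" and f
  assume G: "group G"
  show "model G X S f \<and> (\<forall>x\<in>X. f x = f x)" if "model G X T f"
    using assms(3)[OF G f[OF that]] that by simp
  show "model G X T f \<and> (\<forall>x\<in>X. f x = f x)" if "model G X S f"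
    using assms(3)[OF G f[OF that]] that by simp
qed

definition relabel :: "('x \<Rightarrow> 'y) \<Rightarrow> 'x conj_rel \<Rightarrow> 'y conj_rel" where
  "relabel h = (\<lambda>(c, w, b). (h c, map (apfst h) w, h b))"

lemma val_map: "val G f (map (apfst h) w) = val G (\<lambda>x. f (h x)) w"
  by (induction w) auto

lemma words_map: "w \<in> words X \<Longrightarrow> map (apfst h) w \<in> words (h ` X)"
  by (induction w) auto

lemma relabel_conj_rels: "T \<subseteq> conj_rels X \<Longrightarrow> relabel h ` T \<subseteq> conj_rels (h ` X)"
  by (auto simp: relabel_def words_map)

lemma model_relabel:
  "model G (h ` X) (relabel h ` T) f \<longleftrightarrow> model G X T (\<lambda>x. f (h x))"
  by (fastforce simp: model_def relabel_def val_map)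

lemma pres_relabel:
  assumes T: "T \<subseteq> conj_rels X" and h: "inj_on h X"
  shows "pres X T \<cong> pres (h ` X) (relabel h ` T)"
proof (rule pres_isoI_letters[OF T relabel_conj_rels[OF T],
      where \<phi> = h and \<psi> = "inv_into X h"])
  fix G :: "'a word set monoid" and f
  assume f: "model G X T f"
  have "model G X T (\<lambda>x. f (inv_into X h (h x)))"
    by (rule model_cong[OF T _ f]) (simp add: h)
  then show "model G (h ` X) (relabel h ` T) (\<lambda>y. f (inv_into X h y)) \<and>
      (\<forall>x\<in>X. f (inv_into X h (h x)) = f x)"
    using h by (simp add: model_relabel)
qed (auto simp: model_relabel inv_into_into f_inv_into_f)

section \<open>The group of a Gauss diagram in terms of segments\<close>

definition pointed :: "gauss_diagram \<Rightarrow> (nat \<times> nat) set" where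
  "pointed D = {(i, p). i < length (circles D) \<and> p < length (circles D ! i)}"

definition point :: "gauss_diagram \<Rightarrow> nat \<times> nat \<Rightarrow> endpoint" where
  "point D s = circles D ! fst s ! snd s"

definition seg_of :: "gauss_diagram \<Rightarrow> endpoint \<Rightarrow> nat \<times> nat" where
  "seg_of D e = (SOME s. s \<in> pointed D \<and> point D s = e)"

fun passage :: "gauss_diagram \<Rightarrow> endpoint \<Rightarrow> (nat \<times> nat) word" where
  "passage D (Tail k) = []"
| "passage D (Head k) = [(seg_of D (Tail k), signs D ! k)]"

text \<open>With segments instead of arcs as generators, every endpoint contributes exactly one
  relation. So a circle becomes a cycle of the Wirtinger graph, and a circle without endpoints an
  isolated vertex.\<close>

definition seg_rels :: "gauss_diagram \<Rightarrow> (nat \<times> nat) conj_rel set" where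
  "seg_rels D = (\<lambda>s. (next_seg D s, passage D (point D s), s)) ` pointed D"

definition gauss_rels :: "gauss_diagram \<Rightarrow> (nat \<times> nat) set conj_rel set" where
  "gauss_rels D = (\<lambda>(s, k). (arc_of D (next_seg D s),
     [(arc_of D (seg_of D (Tail k)), signs D ! k)], arc_of D s)) `
     {(s, k). s \<in> pointed D \<and> point D s = Head k}"

lemma distinct_concat_nth:
  assumes "distinct (concat xss)" "i < length xss" "j < length xss"
    "p < length (xss ! i)" "q < length (xss ! j)" "xss ! i ! p = xss ! j ! q"
  shows "i = j \<and> p = q"
  using assms
proof (induction xss arbitrary: i j)
  case (Cons xs xss)
  have "x \<in> set (concat xss)" if "k < length xss" "x \<in> set (xss ! k)" for k x
    using that by force
  then have *: "xs ! a \<noteq> xss ! k ! b" if "a < length xs" "k < length xss" "b < length (xss ! k)" for a b k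
    using Cons.prems(1) that by (metis IntI concat.simps(2) distinct_append empty_iff nth_mem)
  show ?case
    using Cons.prems Cons.IH * *[symmetric]
    by (cases i; cases j) (auto simp: nth_eq_iff_index_eq)
qed simp

lemma endpoint_at_iff: "endpoint_at D i p e \<longleftrightarrow> (i, p) \<in> pointed D \<and> point D (i, p) = e"
  by (auto simp: endpoint_at_def pointed_def point_def)

lemma pointed_subset: "pointed D \<subseteq> segments D"
  by (auto simp: pointed_def segments_def)

lemma next_seg_pointed: "s \<in> pointed D \<Longrightarrow> next_seg D s \<in> pointed D"
  by (auto simp: pointed_def next_seg_def intro!: mod_less_divisor)

lemma finite_segments: "finite (segments D)"
proof -
  have "segments D = (SIGMA i:{..<length (circles D)}. {..<max 1 (length (circles D ! i))})"
    by (auto simp: segments_def)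
  then show ?thesis by simp
qed

locale gauss =
  fixes D :: gauss_diagram
  assumes D: "is_gauss_diagram D"
begin

lemma inj_point: "inj_on (point D) (pointed D)"
  using D distinct_concat_nth[of "circles D"]
  by (fastforce simp: is_gauss_diagram_def inj_on_def pointed_def point_def)

lemma point_image:
  "point D ` pointed D = Tail ` {..<length (signs D)} \<union> Head ` {..<length (signs D)}"
proof -
  have "point D ` pointed D = set (concat (circles D))"
    by (auto simp: pointed_def point_def image_iff in_set_conv_nth) (metis in_set_conv_nth)+
  then show ?thesis using D by (simp add: is_gauss_diagram_def)
qed

lemma seg_of_point [simp]: "s \<in> pointed D \<Longrightarrow> seg_of D (point D s) = s"
  unfolding seg_of_def using inj_point by (auto intro!: some_equality simp: inj_on_def)

lemma point_seg_of:
  assumes "e \<in> point D ` pointed D"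
  shows "seg_of D e \<in> pointed D" "point D (seg_of D e) = e"
  using assms by auto

lemma seg_of_Tail:
  assumes "s \<in> pointed D" "point D s = Head k"
  shows "seg_of D (Tail k) \<in> pointed D" "point D (seg_of D (Tail k)) = Tail k"
proof -
  have "Head k \<in> point D ` pointed D" using assms by force
  then have "Tail k \<in> point D ` pointed D" unfolding point_image by auto
  then show "seg_of D (Tail k) \<in> pointed D" "point D (seg_of D (Tail k)) = Tail k"
    using point_seg_of by blast+
qed

lemma seg_rels: "seg_rels D \<subseteq> conj_rels (segments D)"
proof -
  have "passage D (point D s) \<in> words (segments D)" if "s \<in> pointed D" for s
    using seg_of_Tail[OF that] pointed_subset by (cases "point D s") auto
  then show ?thesis
    using next_seg_pointed pointed_subset by (fastforce simp: seg_rels_def)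
qed

lemma relator_of_gauss_rels: "relator_of ` gauss_rels D = gauss_relators D"
proof
  show "relator_of ` gauss_rels D \<subseteq> gauss_relators D"
  proof
    fix r assume "r \<in> relator_of ` gauss_rels D"
    then obtain s k where s: "s \<in> pointed D" "point D s = Head k"
      and r: "r = relator_of (arc_of D (next_seg D s),
        [(arc_of D (seg_of D (Tail k)), signs D ! k)], arc_of D s)"
      by (auto simp: gauss_rels_def)
    have "Head k \<in> point D ` pointed D" using s by force
    then have k: "k < length (signs D)" unfolding point_image by auto
    obtain i p where t: "seg_of D (Tail k) = (i, p)" by (cases "seg_of D (Tail k)")
    obtain j q where jq: "s = (j, q)" by (cases s)
    show "r \<in> gauss_relators D"
      unfolding gauss_relators_def mem_Collect_eq
      by (rule exI[of _ "arc_of D (i, p)"], rule exI[of _ "arc_of D s"],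
          rule exI[of _ "arc_of D (next_seg D s)"], rule exI[of _ "signs D ! k"], rule exI[of _ k],
          rule exI[of _ i], rule exI[of _ p], rule exI[of _ j], rule exI[of _ q])
        (use s k seg_of_Tail[OF s] in \<open>simp add: r t jq endpoint_at_iff relator_of_def\<close>)
  qed
  show "gauss_relators D \<subseteq> relator_of ` gauss_rels D"
  proof
    fix r assume "r \<in> gauss_relators D"
    then obtain k i p j q where *: "endpoint_at D i p (Tail k)" "endpoint_at D j q (Head k)"
      and r: "r = [(arc_of D (next_seg D (j, q)), Neg), (arc_of D (i, p), opp (signs D ! k)),
        (arc_of D (j, q), Pos), (arc_of D (i, p), signs D ! k)]"
      unfolding gauss_relators_def mem_Collect_eq
      by (elim exE conjE) (rule that, assumption, assumption, simp)
    have "seg_of D (Tail k) = (i, p)"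
      using * seg_of_point[of "(i, p)"] by (simp add: endpoint_at_iff)
    then have "r = relator_of ((\<lambda>(s, k). (arc_of D (next_seg D s),
        [(arc_of D (seg_of D (Tail k)), signs D ! k)], arc_of D s)) ((j, q), k))"
      by (simp add: r relator_of_def)
    moreover have "((j, q), k) \<in> {(s, k). s \<in> pointed D \<and> point D s = Head k}"
      using * by (simp add: endpoint_at_iff)
    ultimately show "r \<in> relator_of ` gauss_rels D"
      unfolding gauss_rels_def by blast
  qed
qed

lemma gauss_group_eq: "gauss_group D = pres (arcs D) (gauss_rels D)"
  by (simp add: gauss_group_def pres_def relator_of_gauss_rels)

lemma tail_join_iff:
  "(s, t) \<in> tail_join D \<longleftrightarrow> s \<in> pointed D \<and> t = next_seg D s \<and> (\<exists>k. point D s = Tail k)"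
  by (cases s) (auto simp: tail_join_def endpoint_at_iff)

lemma same_arc_sym: "(s, t) \<in> same_arc D \<Longrightarrow> (t, s) \<in> same_arc D"
  unfolding same_arc_def by (rule symD[OF sym_rtrancl]) (auto intro: symI)

lemma tail_join_segments:
  "(s, t) \<in> tail_join D \<Longrightarrow> s \<in> segments D \<and> t \<in> segments D"
  using next_seg_pointed by (simp only: tail_join_iff) (blast intro: subsetD[OF pointed_subset])

lemma same_arc_segments:
  assumes "(s, t) \<in> same_arc D" "s \<in> segments D"
  shows "t \<in> segments D"
  using assms unfolding same_arc_def
  by (induction rule: rtrancl_induct) (metis Un_iff converse_iff tail_join_segments)+

lemma same_arc_trans: "(s, t) \<in> same_arc D \<Longrightarrow> (t, u) \<in> same_arc D \<Longrightarrow> (s, u) \<in> same_arc D"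
  unfolding same_arc_def by (rule rtrancl_trans)

lemma arc_of_eq:
  assumes "(s, t) \<in> same_arc D"
  shows "arc_of D s = arc_of D t"
proof -
  have "(s, u) \<in> same_arc D \<longleftrightarrow> (t, u) \<in> same_arc D" for u
    using assms same_arc_sym same_arc_trans by blast
  then show ?thesis by (auto simp: arc_of_def)
qed

lemma arc_of_arcs [simp]: "s \<in> segments D \<Longrightarrow> arc_of D s \<in> arcs D"
  by (auto simp: arcs_def arc_of_def quotient_def)

lemma some_arc:
  assumes "A \<in> arcs D"
  shows "(SOME s. s \<in> A) \<in> segments D" "arc_of D (SOME s. s \<in> A) = A"
proof -
  obtain s where s: "s \<in> segments D" "A = same_arc D `` {s}"
    using assms by (auto simp: arcs_def quotient_def)
  then have "s \<in> A" by (simp add: same_arc_def)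
  then have "(SOME s. s \<in> A) \<in> A" by (rule someI)
  then have *: "(s, SOME s. s \<in> A) \<in> same_arc D" using s(2) by blast
  show "(SOME s. s \<in> A) \<in> segments D"
    using same_arc_segments[OF * s(1)] .
  show "arc_of D (SOME s. s \<in> A) = A"
    using arc_of_eq[OF *] s(2) by (simp only: arc_of_def)
qed

lemma gauss_rels: "gauss_rels D \<subseteq> conj_rels (arcs D)"
  using seg_of_Tail pointed_subset next_seg_pointed
  by (fastforce simp: gauss_rels_def intro!: arc_of_arcs)

text \<open>In a model of \<open>seg_rels\<close> the empty words at the tails force equal values
  along an arc, so any chosen representative gives the value of the arc. Conversely, a model on arcs
  is pulled back along \<open>arc_of\<close>, and the tail relations hold because both segments lie
  on one arc.\<close>

lemma gauss_group_iso: "gauss_group D \<cong> pres (segments D) (seg_rels D)"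
  unfolding gauss_group_eq
proof (rule pres_isoI_letters[OF gauss_rels seg_rels,
      where \<phi> = "\<lambda>A. SOME s. s \<in> A" and \<psi> = "arc_of D"])
  fix G :: "(nat \<times> nat) set word set monoid" and f
  assume G: "group G" and f: "model G (arcs D) (gauss_rels D) f"
  interpret group G by (rule G)
  have c: "f (arc_of D s) \<in> carrier G" if "s \<in> segments D" for s
    using f that by (auto simp: model_def Pi_iff)
  have "f (arc_of D (next_seg D s)) =
      conj_by G (val G (\<lambda>s. f (arc_of D s)) (passage D (point D s))) (f (arc_of D s))"
    if s: "s \<in> pointed D" for s
  proof (cases "point D s")
    case (Tail k)
    then have "(s, next_seg D s) \<in> same_arc D"
      using s by (auto simp: same_arc_def tail_join_iff)
    then show ?thesis
      using Tail c[OF subsetD[OF pointed_subset s]] by (simp add: arc_of_eq[symmetric])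
  next
    case (Head k)
    then have "(arc_of D (next_seg D s), [(arc_of D (seg_of D (Tail k)), signs D ! k)], arc_of D s)
        \<in> gauss_rels D"
      using s by (force simp: gauss_rels_def)
    then show ?thesis
      using f Head by (auto simp: model_def)
  qed
  then show "model G (segments D) (seg_rels D) (\<lambda>s. f (arc_of D s)) \<and>
      (\<forall>A\<in>arcs D. f (arc_of D (SOME s. s \<in> A)) = f A)"
    using c some_arc by (auto simp: model_def seg_rels_def)
next
  fix G :: "(nat \<times> nat) word set monoid" and f
  assume G: "group G" and f: "model G (segments D) (seg_rels D) f"
  interpret group G by (rule G)
  have c: "f s \<in> carrier G" if "s \<in> segments D" for s
    using f that by (auto simp: model_def Pi_iff)
  have rel: "f (next_seg D s) = conj_by G (val G f (passage D (point D s))) (f s)"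
    if "s \<in> pointed D" for s
    using f that by (auto simp: model_def seg_rels_def)
  have tj: "f t = f s" if st: "(s, t) \<in> tail_join D" for s t
  proof -
    obtain k where s: "s \<in> pointed D" "t = next_seg D s" "point D s = Tail k"
      using st unfolding tail_join_iff by blast
    then show ?thesis
      using rel[OF s(1)] c[OF subsetD[OF pointed_subset s(1)]] by simp
  qed
  have same: "f t = f s" if "(s, t) \<in> same_arc D" for s t
    using that unfolding same_arc_def
    by (induction rule: rtrancl_induct) (use tj in \<open>metis Un_iff converse_iff\<close>)+
  have f_some: "f (SOME t. t \<in> arc_of D s) = f s" if "s \<in> segments D" for s
  proof -
    have "s \<in> arc_of D s" by (simp add: arc_of_def same_arc_def)
    then have "(SOME t. t \<in> arc_of D s) \<in> arc_of D s" by (rule someI)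
    then have "(s, SOME t. t \<in> arc_of D s) \<in> same_arc D" by (simp add: arc_of_def)
    then show ?thesis by (rule same)
  qed
  have "model G (arcs D) (gauss_rels D) (\<lambda>A. f (SOME s. s \<in> A))"
    unfolding model_def
  proof (intro conjI ballI)
    show "(\<lambda>A. f (SOME s. s \<in> A)) \<in> arcs D \<rightarrow> carrier G"
      using c some_arc by auto
    fix t assume "t \<in> gauss_rels D"
    then obtain s k where s: "s \<in> pointed D" "point D s = Head k"
      and t: "t = (arc_of D (next_seg D s), [(arc_of D (seg_of D (Tail k)), signs D ! k)], arc_of D s)"
      by (auto simp: gauss_rels_def)
    show "case t of (c, w, b) \<Rightarrow> f (SOME s. s \<in> c) =
        conj_by G (val G (\<lambda>A. f (SOME s. s \<in> A)) w) (f (SOME s. s \<in> b))"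
      using rel[OF s(1)] s seg_of_Tail(1)[OF s] next_seg_pointed[OF s(1)]
      by (simp add: t f_some subsetD[OF pointed_subset])
  qed
  then show "model G (arcs D) (gauss_rels D) (\<lambda>A. f (SOME s. s \<in> A)) \<and>
      (\<forall>s\<in>segments D. f (SOME t. t \<in> arc_of D s) = f s)"
    using f_some by simp
qed (erule some_arc(1) arc_of_arcs)+

end

section \<open>A Wirtinger presentation from a Gauss diagram\<close>

lemma relator_of_nat [simp]: "relator_of = wirtinger_relator"
  by (auto simp: relator_of_def fun_eq_iff)

lemma wirtinger_group_eq: "wirtinger_group (n, rs) = pres {..<n} (set rs)"
  by (simp add: pres_def)

lemma sym_adjacency: "sym (adjacency \<Gamma>)"
  by (auto simp: adjacency_def sym_def insert_commute)

context gauss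
begin

lemma circle_connected:
  fixes h :: "nat \<times> nat \<Rightarrow> nat"
  assumes adj: "\<And>s. s \<in> pointed D \<Longrightarrow> (h s, h (next_seg D s)) \<in> A" and "sym A"
    and "(i, p) \<in> segments D" "(i, q) \<in> segments D"
  shows "(h (i, p), h (i, q)) \<in> A\<^sup>*"
proof -
  have from0: "(h (i, 0), h (i, p)) \<in> A\<^sup>*" if "(i, p) \<in> segments D" for p
    using that
  proof (induction p)
    case (Suc p)
    then have "(i, p) \<in> pointed D" "next_seg D (i, p) = (i, Suc p)" "(i, p) \<in> segments D"
      by (auto simp: segments_def pointed_def next_seg_def)
    then show ?case
      using Suc.IH adj[of "(i, p)"] by (auto intro: rtrancl_into_rtrancl)
  qed simp
  have "(h (i, p), h (i, 0)) \<in> A\<^sup>*"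
    using from0[OF assms(3)] \<open>sym A\<close> by (meson symD sym_rtrancl)
  then show ?thesis
    using from0[OF assms(4)] by (rule rtrancl_trans)
qed

text \<open>A circle with L endpoints yields \<open>max 1 L\<close> vertices and L edges, so its
  Euler characteristic is 0 if L is positive and 1 otherwise. The work lies in showing that the
  components are exactly the circles.\<close>

lemma wirtinger_of_gauss:
  "\<exists>W. is_wirtinger W \<and> gauss_group D \<cong> wirtinger_group W \<and>
     (\<forall>C \<in> components (wirtinger_graph W).
        euler_char (subgraph_on (wirtinger_graph W) C) \<in> {0, 1})"
proof -
  define n where "n = card (segments D)"
  obtain h where "bij_betw h (segments D) {..<n}"
    using ex_bij_betw_finite_nat[OF finite_segments] by (auto simp: n_def atLeast0LessThan)
  then have inj: "inj_on h (segments D)" and h: "h ` segments D = {..<n}"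
    by (auto simp: bij_betw_def)
  have fin: "finite (pointed D)"
    using finite_subset[OF pointed_subset finite_segments] .
  obtain el where el: "set el = pointed D" "distinct el"
    using finite_distinct_list[OF fin] by blast
  define rel where
    "rel s = relabel h (next_seg D s, passage D (point D s), s)" for s
  define W where "W = (n, map rel el)"
  let ?\<Gamma> = "wirtinger_graph W"
  have rels: "set (map rel el) = relabel h ` seg_rels D"
    by (auto simp: rel_def seg_rels_def el)
  then have X: "set (map rel el) \<subseteq> conj_rels {..<n}"
    using relabel_conj_rels[OF seg_rels, of h] by (simp add: h)
  have "(0, 0) \<in> segments D"
    using D by (auto simp: is_gauss_diagram_def segments_def)
  then have "1 \<le> n"
    using finite_segments by (auto simp: n_def Suc_le_eq card_gt_0_iff)
  moreover have "length el \<le> n"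
    unfolding n_def distinct_card[OF el(2), symmetric] el(1)
    by (rule card_mono[OF finite_segments pointed_subset])
  ultimately have W: "is_wirtinger W"
    using X by (auto simp: W_def)
  have iso: "gauss_group D \<cong> wirtinger_group W"
    using iso_trans[OF gauss_group_iso pres_relabel[OF seg_rels inj]]
    by (simp only: W_def wirtinger_group_eq rels h)
  have ends: "ends ?\<Gamma> q = {h (el ! q), h (next_seg D (el ! q))}" if "q < length el" for q
    using that by (auto simp: W_def rel_def relabel_def)
  have graph [simp]: "vertices ?\<Gamma> = {..<n}" "edges ?\<Gamma> = {..<length el}"
    by (simp_all add: W_def)
  have adj: "(u, v) \<in> adjacency ?\<Gamma> \<longleftrightarrow> (\<exists>s \<in> pointed D. {h s, h (next_seg D s)} = {u, v})" for u v
  proof -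
    have "(u, v) \<in> adjacency ?\<Gamma> \<longleftrightarrow>
        (\<exists>q<length el. {h (el ! q), h (next_seg D (el ! q))} = {u, v})"
      by (simp add: adjacency_def Bex_def ends cong: conj_cong)
    also have "\<dots> \<longleftrightarrow> (\<exists>s \<in> set el. {h s, h (next_seg D s)} = {u, v})"
      unfolding in_set_conv_nth Bex_def by blast
    finally show ?thesis by (simp only: el(1))
  qed
  have "euler_char (subgraph_on ?\<Gamma> C) \<in> {0, 1}" if C: "C \<in> components ?\<Gamma>" for C
  proof -
    obtain v where v: "v \<in> h ` segments D" "C = (adjacency ?\<Gamma>)\<^sup>* `` {v}"
      using C unfolding components_def graph(1) h by (rule quotientE)
    then obtain i p where ip: "(i, p) \<in> segments D" and Cip: "C = (adjacency ?\<Gamma>)\<^sup>* `` {h (i, p)}"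
      by (metis imageE surj_pair)
    let ?L = "length (circles D ! i)"
    have i: "i < length (circles D)" using ip by (auto simp: segments_def)
    have segs: "(i, q) \<in> segments D \<longleftrightarrow> q < max 1 ?L" for q
      using i by (auto simp: segments_def)
    have next_fst: "fst (next_seg D s) = fst s" for s
      by (cases s) (simp add: next_seg_def)
    \<comment> \<open>Edges join consecutive segments of one circle, and \<open>h\<close> is
      injective on segments, so a path in the graph never leaves circle \<open>i\<close>.\<close>
    have "\<exists>q. (i, q) \<in> segments D \<and> u = h (i, q)"
      if "(h (i, p), u) \<in> (adjacency ?\<Gamma>)\<^sup>*" for u
      using that
    proof (induction rule: rtrancl_induct)
      case base
      then show ?case using ip by blast
    next
      case (step u v)
      then obtain q s where q: "(i, q) \<in> segments D" "u = h (i, q)"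
        and s: "s \<in> pointed D" "{h s, h (next_seg D s)} = {h (i, q), v}"
        by (auto simp: adj)
      have ss: "s \<in> segments D" "next_seg D s \<in> segments D"
        using s next_seg_pointed pointed_subset by blast+
      have "h s = h (i, q) \<and> v = h (next_seg D s) \<or> h (next_seg D s) = h (i, q) \<and> v = h s"
        using s(2) by (auto simp: doubleton_eq_iff)
      then have "s = (i, q) \<and> v = h (next_seg D s) \<or> next_seg D s = (i, q) \<and> v = h s"
        using inj_onD[OF inj] ss q(1) by blast
      then show ?case
        using ss next_fst[of s] by (cases s; cases "next_seg D s") auto
    qed
    moreover have "(h (i, p), h (i, q)) \<in> (adjacency ?\<Gamma>)\<^sup>*" if "(i, q) \<in> segments D" for q
      by (rule circle_connected[OF _ sym_adjacency ip that]) (auto simp: adj)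
    ultimately have CL: "C = h ` ({i} \<times> {..<max 1 ?L})"
      unfolding Cip using segs by auto
    have sub: "{i} \<times> {..<max 1 ?L} \<subseteq> segments D"
      using segs by auto
    have "card C = max 1 ?L"
      using card_image[OF inj_on_subset[OF inj sub]] by (simp add: CL card_cartesian_product)
    moreover have "{..<n} \<inter> C = C"
      using sub h by (auto simp: CL)
    ultimately have verts: "card ({..<n} \<inter> C) = max 1 ?L" by simp
    have "h s \<in> C \<longleftrightarrow> fst s = i" if "s \<in> segments D" for s
    proof
      assume "h s \<in> C"
      then obtain t where t: "t \<in> {i} \<times> {..<max 1 ?L}" "h s = h t" by (auto simp: CL)
      then have "s = t" using inj_onD[OF inj] that sub by blast
      then show "fst s = i" using t by auto
    next
      assume "fst s = i"
      then show "h s \<in> C" using that segs by (cases s) (auto simp: CL)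
    qed
    then have "ends ?\<Gamma> q \<subseteq> C \<longleftrightarrow> fst (el ! q) = i" if "q < length el" for q
      using ends[OF that] that next_fst next_seg_pointed pointed_subset el(1) nth_mem[OF that]
      by (metis (no_types, lifting) insert_subset empty_subsetI subsetD)
    then have "{e \<in> {..<length el}. ends ?\<Gamma> e \<subseteq> C} = {q \<in> {..<length el}. fst (el ! q) = i}"
      by auto
    moreover have "card \<dots> = ?L"
    proof -
      have "(!) el ` {q \<in> {..<length el}. fst (el ! q) = i} = {s \<in> set el. fst s = i}"
        by (auto simp: set_conv_nth)
      also have "\<dots> = {i} \<times> {..<?L}"
        using i by (auto simp: el pointed_def)
      finally have "card ((!) el ` {q \<in> {..<length el}. fst (el ! q) = i}) = ?L"
        by (simp add: card_cartesian_product)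
      moreover have "inj_on ((!) el) {q \<in> {..<length el}. fst (el ! q) = i}"
        using el(2) by (auto simp: inj_on_def nth_eq_iff_index_eq)
      ultimately show ?thesis by (simp add: card_image)
    qed
    ultimately have "card {e \<in> {..<length el}. ends ?\<Gamma> e \<subseteq> C} = ?L" by simp
    then show ?thesis
      using verts by (auto simp: euler_char_def subgraph_on_def)
  qed
  then show ?thesis
    using W iso by (intro exI[of _ W]) simp
qed

end

section \<open>Star form of a Wirtinger presentation\<close>

text \<open>Each component is described by a root: the generator \<open>v\<close> is the conjugate of the root
  \<open>\<rho> v\<close> by \<open>W v\<close>, and the words in \<open>U (\<rho> v)\<close>, one for each independent cycle of the component,
  commute with the root.\<close>

definition star_words :: "nat \<Rightarrow> (nat \<Rightarrow> nat) \<Rightarrow> (nat \<Rightarrow> nat word) \<Rightarrow> (nat \<Rightarrow> nat word list) \<Rightarrow> bool" where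
  "star_words n \<rho> W U \<longleftrightarrow> (\<forall>v<n. \<rho> v < n \<and> \<rho> (\<rho> v) = \<rho> v \<and> W (\<rho> v) = [] \<and>
     W v \<in> words {..<n} \<and> set (U v) \<subseteq> words {..<n})"

definition star_model ::
  "('g, 'c) monoid_scheme \<Rightarrow> nat \<Rightarrow> (nat \<Rightarrow> nat) \<Rightarrow> (nat \<Rightarrow> nat word) \<Rightarrow> (nat \<Rightarrow> nat word list) \<Rightarrow>
    (nat \<Rightarrow> 'g) \<Rightarrow> bool" where
  "star_model G n \<rho> W U f \<longleftrightarrow>
     (\<forall>v<n. f v = conj_by G (val G f (W v)) (f (\<rho> v)) \<and>
       (\<forall>u \<in> set (U (\<rho> v)). conj_by G (val G f u) (f (\<rho> v)) = f (\<rho> v)))"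

text \<open>\<open>W j\<close> leads from the root of \<open>j\<close> to \<open>j\<close>, then
  \<open>w\<close> from \<open>j\<close> to \<open>i\<close>, then the inverse of \<open>W i\<close>
  from \<open>i\<close> to its root. The relation of an edge thus becomes a relation between
  roots.\<close>

definition bridge :: "(nat \<Rightarrow> nat word) \<Rightarrow> nat \<times> nat word \<times> nat \<Rightarrow> nat word" where
  "bridge W = (\<lambda>(i, w, j). W j @ w @ inv_word (W i))"

text \<open>Let \<open>P\<close> carry the root \<open>s\<close> to the root \<open>r\<close>. This
  and the next two definitions hang the component of \<open>r\<close> below \<open>s\<close>: paths
  are prefixed by \<open>P\<close>, and a loop \<open>u\<close> at \<open>r\<close> becomes the loop
  \<open>P u P\<inverse>\<close> at \<open>s\<close>.\<close>

definition merge_root :: "(nat \<Rightarrow> nat) \<Rightarrow> nat \<Rightarrow> nat \<Rightarrow> nat \<Rightarrow> nat" where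
  "merge_root \<rho> r s v = (if \<rho> v = r then s else \<rho> v)"

definition merge_word :: "(nat \<Rightarrow> nat) \<Rightarrow> (nat \<Rightarrow> nat word) \<Rightarrow> nat \<Rightarrow> nat word \<Rightarrow> nat \<Rightarrow> nat word" where
  "merge_word \<rho> W r P v = (if \<rho> v = r then P @ W v else W v)"

definition merge_stab :: "(nat \<Rightarrow> nat word list) \<Rightarrow> nat \<Rightarrow> nat \<Rightarrow> nat word \<Rightarrow> nat \<Rightarrow> nat word list" where
  "merge_stab U r s P = U(s := U s @ map (\<lambda>u. P @ u @ inv_word P) (U r))"

lemma bridge_words:
  "star_words n \<rho> W U \<Longrightarrow> i < n \<Longrightarrow> j < n \<Longrightarrow> w \<in> words {..<n} \<Longrightarrow>
    bridge W (i, w, j) \<in> words {..<n}"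
  by (simp add: star_words_def bridge_def)

context group
begin

lemma bridge_iff:
  assumes f: "f \<in> {..<n} \<rightarrow> carrier G" and st: "star_words n \<rho> W U"
    and ij: "i < n" "j < n" "w \<in> words {..<n}"
    and m: "star_model G n \<rho> W U f"
  shows "f i = conj_by G (val G f w) (f j) \<longleftrightarrow>
    f (\<rho> i) = conj_by G (val G f (bridge W (i, w, j))) (f (\<rho> j))"
proof -
  have Ww: "W i \<in> words {..<n}" "W j \<in> words {..<n}" and r: "\<rho> i < n" "\<rho> j < n"
    using st ij by (auto simp: star_words_def)
  define a b x r s where "a = val G f (W i)" and "b = val G f (W j)" and "x = val G f w"
    and "r = f (\<rho> i)" and "s = f (\<rho> j)"
  have c: "a \<in> carrier G" "b \<in> carrier G" "x \<in> carrier G" "r \<in> carrier G" "s \<in> carrier G"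
    using f Ww ij r by (auto simp: a_def b_def x_def r_def s_def)
  have "f i = conj_by G a r" "f j = conj_by G b s"
    using m ij by (auto simp: star_model_def a_def b_def r_def s_def)
  moreover have "val G f (bridge W (i, w, j)) = b \<otimes> (x \<otimes> inv a)"
    using f Ww ij
    by (simp add: bridge_def a_def b_def x_def val_append[of f "{..<n}"] val_inv_word[of f "{..<n}"])
  moreover have "conj_by G a r = conj_by G x (conj_by G b s) \<longleftrightarrow>
      r = conj_by G (b \<otimes> (x \<otimes> inv a)) s"
    using c conj_by_inv_eq_iff[of a r "conj_by G x (conj_by G b s)"]
      conj_by_inv_eq_iff[of "inv a" "conj_by G x (conj_by G b s)" r] by auto
  ultimately show ?thesis by (simp add: x_def r_def s_def)
qed

text \<open>An edge inside a component closes a cycle; read at the common root by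
  \<open>bridge_iff\<close>, its relation is one more word that commutes with the root.\<close>

lemma star_model_loop:
  assumes f: "f \<in> {..<n} \<rightarrow> carrier G" and st: "star_words n \<rho> W U"
    and ij: "i < n" "j < n" "w \<in> words {..<n}" and eq: "\<rho> i = \<rho> j"
  shows "star_model G n \<rho> W (U(\<rho> i := bridge W (i, w, j) # U (\<rho> i))) f \<longleftrightarrow>
    f i = conj_by G (val G f w) (f j) \<and> star_model G n \<rho> W U f"
proof -
  have "star_model G n \<rho> W (U(\<rho> i := bridge W (i, w, j) # U (\<rho> i))) f \<longleftrightarrow>
      f (\<rho> i) = conj_by G (val G f (bridge W (i, w, j))) (f (\<rho> j)) \<and> star_model G n \<rho> W U f"
    unfolding star_model_def using ij eq by (auto split: if_splits)
  then show ?thesis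
    using bridge_iff[OF f st ij] by blast
qed

text \<open>An edge between two components expresses one root by the other, so it uses up a root and
  creates no loop. Under that equation the old and the merged system agree, and the merged system
  implies the equation.\<close>

lemma star_model_merge:
  assumes f: "f \<in> {..<n} \<rightarrow> carrier G" and st: "star_words n \<rho> W U"
    and ij: "i < n" "j < n" "w \<in> words {..<n}" and neq: "\<rho> i \<noteq> \<rho> j"
  defines "P \<equiv> bridge W (i, w, j)"
  shows "star_model G n (merge_root \<rho> (\<rho> i) (\<rho> j)) (merge_word \<rho> W (\<rho> i) P)
      (merge_stab U (\<rho> i) (\<rho> j) P) f \<longleftrightarrow>
    f i = conj_by G (val G f w) (f j) \<and> star_model G n \<rho> W U f"
    (is "star_model G n ?\<rho> ?W ?U f \<longleftrightarrow> _")
proof -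
  have P: "P \<in> words {..<n}" unfolding P_def using bridge_words[OF st ij] .
  have st: "\<rho> v < n" "\<rho> (\<rho> v) = \<rho> v" "W (\<rho> v) = []" "W v \<in> words {..<n}" "set (U v) \<subseteq> words {..<n}"
    if "v < n" for v
    using st that by (auto simp: star_words_def)
  define p where "p = val G f P"
  have fc [simp]: "f v \<in> carrier G" if "v < n" for v using f that by auto
  have pc [simp]: "p \<in> carrier G" unfolding p_def by (rule val_closed[OF f P])
  have wc [simp]: "val G f u \<in> carrier G" if "u \<in> words {..<n}" for u
    by (rule val_closed[OF f that])
  have vPW: "val G f (P @ W v) = p \<otimes> val G f (W v)" if "v < n" for v
    unfolding p_def by (rule val_append[OF f P st(4)[OF that]])
  have vPu: "val G f (P @ u @ inv_word P) = p \<otimes> (val G f u \<otimes> inv p)" if "u \<in> words {..<n}" for u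
    unfolding p_def using P that val_inv_word[OF f P]
    by (simp add: val_append[OF f])
  have main: "star_model G n ?\<rho> ?W ?U f \<longleftrightarrow> star_model G n \<rho> W U f"
    if fr: "f (\<rho> i) = conj_by G p (f (\<rho> j))"
  proof -
    have "f v = conj_by G (val G f (?W v)) (f (?\<rho> v)) \<longleftrightarrow>
        f v = conj_by G (val G f (W v)) (f (\<rho> v))" if v: "v < n" for v
      using v fr st[OF v] st[OF ij(1)] st[OF ij(2)]
      by (simp add: merge_word_def merge_root_def vPW)
    \<comment> \<open>The root of \<open>i\<close> is the conjugate by \<open>p\<close> of the root
      of \<open>j\<close>, so acting on the latter with \<open>p\<close>, then \<open>u\<close>,
      then the inverse of \<open>p\<close> fixes it exactly if \<open>u\<close> fixes the
      former.\<close>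
    moreover have "conj_by G (val G f (P @ u @ inv_word P)) (f (\<rho> j)) = f (\<rho> j) \<longleftrightarrow>
        conj_by G (val G f u) (f (\<rho> i)) = f (\<rho> i)" if "u \<in> set (U (\<rho> i))" for u
    proof -
      have u: "u \<in> words {..<n}" using that st[OF st(1)[OF ij(1)]] by auto
      have "conj_by G (val G f (P @ u @ inv_word P)) (f (\<rho> j)) =
          conj_by G (inv p) (conj_by G (val G f u) (f (\<rho> i)))"
        using u st[OF ij(1)] st[OF ij(2)] by (simp add: vPu fr)
      then show ?thesis
        using u st[OF ij(1)] st[OF ij(2)] by (simp add: conj_by_inv_eq_iff fr[symmetric])
    qed
    then have "(\<forall>v<n. \<forall>u\<in>set (?U (?\<rho> v)). conj_by G (val G f u) (f (?\<rho> v)) = f (?\<rho> v)) \<longleftrightarrow>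
        (\<forall>v<n. \<forall>u\<in>set (U (\<rho> v)). conj_by G (val G f u) (f (\<rho> v)) = f (\<rho> v))" (is "?A \<longleftrightarrow> ?B")
    proof -
      assume *: "\<And>u. u \<in> set (U (\<rho> i)) \<Longrightarrow>
        conj_by G (val G f (P @ u @ inv_word P)) (f (\<rho> j)) = f (\<rho> j) \<longleftrightarrow>
        conj_by G (val G f u) (f (\<rho> i)) = f (\<rho> i)"
      have Us: "set (?U (\<rho> j)) = set (U (\<rho> j)) \<union> (\<lambda>u. P @ u @ inv_word P) ` set (U (\<rho> i))"
        by (simp add: merge_stab_def)
      have Uo: "?U v = U v" if "v \<noteq> \<rho> j" for v
        using that by (simp add: merge_stab_def)
      show ?thesis
      proof
        assume A: ?A
        have "conj_by G (val G f u) (f (\<rho> v)) = f (\<rho> v)" if v: "v < n" "u \<in> set (U (\<rho> v))" for u v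
        proof (cases "\<rho> v = \<rho> i")
          case True
          have "?\<rho> i = \<rho> j" by (simp add: merge_root_def)
          moreover have "P @ u @ inv_word P \<in> set (?U (\<rho> j))"
            using v True unfolding Us by auto
          ultimately have "conj_by G (val G f (P @ u @ inv_word P)) (f (\<rho> j)) = f (\<rho> j)"
            using A ij(1) by metis
          then show ?thesis using * v True by simp
        next
          case False
          then have "?\<rho> v = \<rho> v" by (simp add: merge_root_def)
          moreover have "u \<in> set (?U (\<rho> v))"
            using v Us Uo by (cases "\<rho> v = \<rho> j") auto
          ultimately show ?thesis using A v(1) by metis
        qed
        then show ?B by blast
      next
        assume B: ?B
        have "conj_by G (val G f u) (f (?\<rho> v)) = f (?\<rho> v)" if v: "v < n" "u \<in> set (?U (?\<rho> v))" for u v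
        proof (cases "?\<rho> v = \<rho> j")
          case True
          then consider "u \<in> set (U (\<rho> j))" | u' where "u = P @ u' @ inv_word P" "u' \<in> set (U (\<rho> i))"
            using v unfolding True Us by auto
          then show ?thesis
            by cases (use B ij * in \<open>auto simp: True\<close>)
        next
          case False
          then have "?\<rho> v = \<rho> v" by (auto simp: merge_root_def split: if_splits)
          then show ?thesis using B v Uo False by auto
        qed
        then show ?A by blast
      qed
    qed
    ultimately show ?thesis
      unfolding star_model_def by meson
  qed
  \<comment> \<open>The word of the old root was empty, so its merged word is \<open>P\<close>, and
    its star equation is the edge relation read at the roots.\<close>
  have "f (\<rho> i) = conj_by G p (f (\<rho> j))" if "star_model G n ?\<rho> ?W ?U f"
  proof -
    have "f (\<rho> i) = conj_by G (val G f (?W (\<rho> i))) (f (?\<rho> (\<rho> i)))"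
      using that st[OF ij(1)] by (auto simp: star_model_def)
    then show ?thesis
      using st[OF ij(1)] by (simp add: merge_word_def merge_root_def p_def)
  qed
  then show ?thesis
    using main bridge_iff[OF f \<open>star_words n \<rho> W U\<close> ij] unfolding p_def P_def by blast
qed

lemma star_model_id:
  "f \<in> {..<n} \<rightarrow> carrier G \<Longrightarrow> star_model G n (\<lambda>v. v) (\<lambda>_. []) (\<lambda>_. []) f"
  by (simp add: star_model_def Pi_iff)

end

section \<open>Existence of the star form and the count of independent cycles\<close>

definition edge_rel :: "nat conj_rel list \<Rightarrow> (nat \<times> nat) set" where
  "edge_rel rs = {(i, j). \<exists>w. (i, w, j) \<in> set rs \<or> (j, w, i) \<in> set rs}"

text \<open>The first end decides where an edge is counted; in a \<open>star_form\<close> the other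
  end has the same root.\<close>

definition num_rels :: "(nat \<Rightarrow> nat) \<Rightarrow> nat conj_rel list \<Rightarrow> nat \<Rightarrow> nat" where
  "num_rels \<rho> rs r = length (filter (\<lambda>(i, w, j). \<rho> i = r) rs)"

text \<open>The invariant of an induction over the relations. Its second and third clauses identify
  the classes of \<open>\<rho>\<close> with the components. The counting clause reads edges + 1 =
  vertices + loops, that is, the Euler characteristic is one minus the number of loop words. The
  type of \<open>G\<close> is the one that \<open>pres_cong\<close> demands for generators in
  \<open>nat\<close>.\<close>

definition star_form :: "nat \<Rightarrow> nat conj_rel list \<Rightarrow> (nat \<Rightarrow> nat) \<Rightarrow> (nat \<Rightarrow> nat word) \<Rightarrow>
    (nat \<Rightarrow> nat word list) \<Rightarrow> bool" where
  "star_form n rs \<rho> W U \<longleftrightarrow> star_words n \<rho> W U \<and>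
     (\<forall>(i, w, j) \<in> set rs. \<rho> i = \<rho> j) \<and>
     (\<forall>v<n. (v, \<rho> v) \<in> (edge_rel rs)\<^sup>*) \<and>
     (\<forall>v<n. num_rels \<rho> rs (\<rho> v) + 1 = card {u. u < n \<and> \<rho> u = \<rho> v} + length (U (\<rho> v))) \<and>
     (\<forall>(G :: nat word set monoid) f. group G \<longrightarrow> f \<in> {..<n} \<rightarrow> carrier G \<longrightarrow>
        (model G {..<n} (set rs) f \<longleftrightarrow> star_model G n \<rho> W U f))"

lemma edge_rel_Cons:
  "edge_rel rs \<subseteq> edge_rel (t # rs)" "(i, j) \<in> edge_rel ((i, w, j) # rs)"
  by (auto simp: edge_rel_def)

lemma sym_edge_rel: "sym (edge_rel rs)"
  by (auto simp: edge_rel_def sym_def)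

lemma num_rels_merge:
  assumes "r \<noteq> s"
  shows "num_rels (merge_root \<rho> r s) rs s = num_rels \<rho> rs r + num_rels \<rho> rs s"
    "t \<noteq> r \<Longrightarrow> t \<noteq> s \<Longrightarrow> num_rels (merge_root \<rho> r s) rs t = num_rels \<rho> rs t"
  using assms by (induction rs) (auto simp: num_rels_def merge_root_def)

text \<open>Edges are added one at a time, as in growing a spanning forest: an edge inside a class
  adds a loop word, an edge between two classes merges them.\<close>

lemma star_form_exists:
  assumes "set rs \<subseteq> conj_rels {..<n}"
  shows "\<exists>\<rho> W U. star_form n rs \<rho> W U"
  using assms
proof (induction rs)
  case Nil
  have "{u. u < n \<and> u = v} = {v}" if "v < n" for v using that by auto
  moreover have "model G {..<n} (set []) f \<longleftrightarrow> star_model G n (\<lambda>v. v) (\<lambda>_. []) (\<lambda>_. []) f"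
    if "group G" "f \<in> {..<n} \<rightarrow> carrier G" for G :: "nat word set monoid" and f
    using group.star_model_id[OF that] that(2) by (simp add: model_def)
  ultimately have "star_form n [] (\<lambda>v. v) (\<lambda>_. []) (\<lambda>_. [])"
    unfolding star_form_def by (simp add: star_words_def num_rels_def)
  then show ?case by blast
next
  case (Cons t rs)
  obtain i w j where t: "t = (i, w, j)" by (cases t)
  obtain \<rho> W U where sf: "star_form n rs \<rho> W U" using Cons by auto
  have ij: "i < n" "j < n" "w \<in> words {..<n}" using Cons.prems t by auto
  define P where "P = bridge W (i, w, j)"
  have st: "star_words n \<rho> W U" using sf by (simp add: star_form_def)
  have P: "P \<in> words {..<n}" unfolding P_def using bridge_words[OF st ij] .
  have st': "\<rho> v < n" "\<rho> (\<rho> v) = \<rho> v" "W (\<rho> v) = []" "W v \<in> words {..<n}" "set (U v) \<subseteq> words {..<n}"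
    if "v < n" for v
    using st that by (auto simp: star_words_def)
  have inv: "\<rho> a = \<rho> b" if "(a, u, b) \<in> set rs" for a u b
    using sf that by (auto simp: star_form_def)
  have count: "num_rels \<rho> rs (\<rho> v) + 1 = card {u. u < n \<and> \<rho> u = \<rho> v} + length (U (\<rho> v))"
    if "v < n" for v
    using sf that by (simp add: star_form_def)
  have reach: "(v, \<rho> v) \<in> (edge_rel (t # rs))\<^sup>*" if "v < n" for v
  proof -
    have "(v, \<rho> v) \<in> (edge_rel rs)\<^sup>*" using sf that by (simp add: star_form_def)
    then show ?thesis by (rule subsetD[OF rtrancl_mono[OF edge_rel_Cons(1)]])
  qed
  have model: "model G {..<n} (set (t # rs)) f \<longleftrightarrow>
      f i = conj_by G (val G f w) (f j) \<and> star_model G n \<rho> W U f"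
    if "group G" "f \<in> {..<n} \<rightarrow> carrier G" for G :: "nat word set monoid" and f
  proof -
    have "model G {..<n} (set (t # rs)) f \<longleftrightarrow>
        f i = conj_by G (val G f w) (f j) \<and> model G {..<n} (set rs) f"
      unfolding model_def t using that(2) by simp
    then show ?thesis using sf that by (simp add: star_form_def)
  qed
  show ?case
  proof (cases "\<rho> i = \<rho> j")
    case True
    let ?U = "U(\<rho> i := P # U (\<rho> i))"
    have "star_words n \<rho> W ?U"
      using st P by (auto simp: star_words_def)
    moreover have "num_rels \<rho> (t # rs) (\<rho> v) + 1 =
        card {u. u < n \<and> \<rho> u = \<rho> v} + length (?U (\<rho> v))" if "v < n" for v
      using count[OF that] by (cases "\<rho> v = \<rho> i") (auto simp: num_rels_def t)
    moreover have "model G {..<n} (set (t # rs)) f \<longleftrightarrow> star_model G n \<rho> W ?U f"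
      if "group G" "f \<in> {..<n} \<rightarrow> carrier G" for G :: "nat word set monoid" and f
      using group.star_model_loop[OF that st ij True] model[OF that] by (simp only: P_def)
    moreover have "\<rho> a = \<rho> b" if "(a, u, b) \<in> set (t # rs)" for a u b
      using that inv[of a u b] True by (auto simp: t)
    ultimately have "star_form n (t # rs) \<rho> W ?U"
      unfolding star_form_def using reach by blast
    then show ?thesis by blast
  next
    case False
    let ?\<rho> = "merge_root \<rho> (\<rho> i) (\<rho> j)" and ?W = "merge_word \<rho> W (\<rho> i) P"
      and ?U = "merge_stab U (\<rho> i) (\<rho> j) P"
    have "star_words n ?\<rho> ?W ?U"
      unfolding star_words_def
    proof (intro allI impI conjI)
      fix v assume v: "v < n"
      show "?\<rho> v < n" "?\<rho> (?\<rho> v) = ?\<rho> v" "?W (?\<rho> v) = []" "?W v \<in> words {..<n}"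
        using st'[OF v] st'[OF ij(2)] False P by (auto simp: merge_root_def merge_word_def)
      show "set (?U v) \<subseteq> words {..<n}"
        using st'(5)[OF v] st'(5)[OF st'(1)[OF ij(1)]] P by (auto simp: merge_stab_def)
    qed
    \<comment> \<open>The path runs from \<open>v\<close> to the old root, back to \<open>i\<close>,
      across the new edge to \<open>j\<close> and on to the root of \<open>j\<close>.\<close>
    moreover have "(v, ?\<rho> v) \<in> (edge_rel (t # rs))\<^sup>*" if v: "v < n" for v
    proof (cases "\<rho> v = \<rho> i")
      case True
      have "(\<rho> i, i) \<in> (edge_rel (t # rs))\<^sup>*"
        using reach[OF ij(1)] sym_rtrancl[OF sym_edge_rel] by (meson symD)
      moreover have "(i, j) \<in> (edge_rel (t # rs))\<^sup>*"
        unfolding t using edge_rel_Cons(2) by blast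
      ultimately have "(v, \<rho> j) \<in> (edge_rel (t # rs))\<^sup>*"
        using reach[OF v] reach[OF ij(2)] True by (metis rtrancl_trans)
      then show ?thesis using True by (simp add: merge_root_def)
    next
      case False
      then show ?thesis using reach[OF v] by (simp add: merge_root_def)
    qed
    \<comment> \<open>The two old balances of a merged class add up to \<open>+ 2\<close> on the
      side of the edges: one is the \<open>+ 1\<close> of the new balance, the other is the new
      edge.\<close>
    moreover have "num_rels ?\<rho> (t # rs) (?\<rho> v) + 1 =
        card {u. u < n \<and> ?\<rho> u = ?\<rho> v} + length (?U (?\<rho> v))" if v: "v < n" for v
    proof (cases "?\<rho> v = \<rho> j")
      case True
      have "{u. u < n \<and> ?\<rho> u = \<rho> j} = {u. u < n \<and> \<rho> u = \<rho> i} \<union> {u. u < n \<and> \<rho> u = \<rho> j}"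
        by (auto simp: merge_root_def)
      moreover have "card ({u. u < n \<and> \<rho> u = \<rho> i} \<union> {u. u < n \<and> \<rho> u = \<rho> j}) =
          card {u. u < n \<and> \<rho> u = \<rho> i} + card {u. u < n \<and> \<rho> u = \<rho> j}"
        by (rule card_Un_disjoint) (use False in auto)
      moreover have "num_rels ?\<rho> (t # rs) (\<rho> j) = Suc (num_rels ?\<rho> rs (\<rho> j))"
        by (simp add: num_rels_def t merge_root_def)
      ultimately show ?thesis
        using count[OF ij(1)] count[OF ij(2)] num_rels_merge(1)[OF False, of \<rho> rs]
        unfolding True by (simp add: merge_stab_def)
    next
      case F: False
      then have v': "?\<rho> v = \<rho> v" "\<rho> v \<noteq> \<rho> i" by (auto simp: merge_root_def split: if_splits)
      have "{u. u < n \<and> ?\<rho> u = \<rho> v} = {u. u < n \<and> \<rho> u = \<rho> v}"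
        using F v' by (auto simp: merge_root_def)
      moreover have "num_rels ?\<rho> (t # rs) (\<rho> v) = num_rels ?\<rho> rs (\<rho> v)"
        using F v' by (auto simp: num_rels_def t merge_root_def)
      ultimately show ?thesis
        using count[OF v] num_rels_merge(2)[OF False v'(2), of \<rho> rs] F
        unfolding v'(1) by (simp add: merge_stab_def)
    qed
    moreover have "model G {..<n} (set (t # rs)) f \<longleftrightarrow> star_model G n ?\<rho> ?W ?U f"
      if "group G" "f \<in> {..<n} \<rightarrow> carrier G" for G :: "nat word set monoid" and f
      using group.star_model_merge[OF that st ij False] model[OF that] by (simp only: P_def)
    moreover have "?\<rho> a = ?\<rho> b" if "(a, u, b) \<in> set (t # rs)" for a u b
      using that inv[of a u b] by (auto simp: t merge_root_def)
    ultimately have "star_form n (t # rs) ?\<rho> ?W ?U"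
      unfolding star_form_def by blast
    then show ?thesis by blast
  qed
qed

text \<open>Since \<open>\<rho>\<close> is constant along edges, a component stays within a class;
  since every vertex is linked to its root, a class is connected.\<close>

lemma component_eq:
  assumes v: "v < n" and sf: "star_form n rs \<rho> W U" and rs: "set rs \<subseteq> conj_rels {..<n}"
  shows "(adjacency (wirtinger_graph (n, rs)))\<^sup>* `` {v} = {u. u < n \<and> \<rho> u = \<rho> v}"
proof -
  let ?A = "adjacency (wirtinger_graph (n, rs))"
  have inv: "\<rho> a = \<rho> b" if "(a, u, b) \<in> set rs" for a u b
    using sf that by (auto simp: star_form_def)
  have reach: "(u, \<rho> u) \<in> (edge_rel rs)\<^sup>*" if "u < n" for u
    using sf that by (simp add: star_form_def)
  have A: "(a, b) \<in> ?A \<longleftrightarrow> (a, b) \<in> edge_rel rs" for a b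
  proof -
    have "(a, b) \<in> ?A \<longleftrightarrow> (\<exists>q<length rs. {fst (rs ! q), snd (snd (rs ! q))} = {a, b})"
      by (simp add: adjacency_def split_beta Bex_def)
    also have "\<dots> \<longleftrightarrow> (\<exists>t \<in> set rs. {fst t, snd (snd t)} = {a, b})"
      unfolding in_set_conv_nth Bex_def by blast
    also have "\<dots> \<longleftrightarrow> (a, b) \<in> edge_rel rs"
      by (force simp: edge_rel_def doubleton_eq_iff)
    finally show ?thesis .
  qed
  then have A: "?A = edge_rel rs" by auto
  have "u < n \<and> \<rho> u = \<rho> v" if "(v, u) \<in> (edge_rel rs)\<^sup>*" for u
    using that
  proof (induction rule: rtrancl_induct)
    case (step a b)
    then obtain w where "(a, w, b) \<in> set rs \<or> (b, w, a) \<in> set rs"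
      by (auto simp: edge_rel_def)
    then show ?case using step.IH inv rs by auto
  qed (use v in simp)
  moreover have "(v, u) \<in> (edge_rel rs)\<^sup>*" if "u < n" "\<rho> u = \<rho> v" for u
    using reach[OF v] reach[OF that(1)] that(2) sym_rtrancl[OF sym_edge_rel]
    by (metis rtrancl_trans symD)
  ultimately have "(v, u) \<in> (edge_rel rs)\<^sup>* \<longleftrightarrow> u < n \<and> \<rho> u = \<rho> v" for u
    by metis
  then show ?thesis by (simp only: A set_eq_iff Image_singleton_iff mem_Collect_eq) simp
qed

lemma euler_char_component:
  assumes v: "v < n" and sf: "star_form n rs \<rho> W U" and rs: "set rs \<subseteq> conj_rels {..<n}"
  shows "euler_char (subgraph_on (wirtinger_graph (n, rs)) {u. u < n \<and> \<rho> u = \<rho> v}) =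
    1 - int (length (U (\<rho> v)))"
proof -
  let ?C = "{u. u < n \<and> \<rho> u = \<rho> v}"
  \<comment> \<open>Both ends of an edge have the same root, so the first end decides membership,
    just as in \<open>num_rels\<close>.\<close>
  have ends: "(case rs ! q of (i, w, j) \<Rightarrow> {i, j}) \<subseteq> ?C \<longleftrightarrow> (case rs ! q of (i, w, j) \<Rightarrow> \<rho> i = \<rho> v)"
    if "q < length rs" for q
  proof -
    obtain i w j where t: "rs ! q = (i, w, j)" by (cases "rs ! q")
    then have "(i, w, j) \<in> set rs" using nth_mem[OF that] by simp
    then have "\<rho> i = \<rho> j" "i < n" "j < n" using sf rs by (auto simp: star_form_def)
    then show ?thesis by (simp add: t)
  qed
  have "{q \<in> {..<length rs}. (case rs ! q of (i, w, j) \<Rightarrow> {i, j}) \<subseteq> ?C} =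
      {q. q < length rs \<and> (case rs ! q of (i, w, j) \<Rightarrow> \<rho> i = \<rho> v)}"
    unfolding lessThan_iff by (rule Collect_cong, rule conj_cong[OF HOL.refl], rule ends)
  then have "card {q \<in> {..<length rs}. (case rs ! q of (i, w, j) \<Rightarrow> {i, j}) \<subseteq> ?C} =
      num_rels \<rho> rs (\<rho> v)"
    by (simp only: num_rels_def length_filter_conv_card)
  moreover have "{..<n} \<inter> ?C = ?C" by auto
  moreover have "num_rels \<rho> rs (\<rho> v) + 1 = card ?C + length (U (\<rho> v))"
    using sf v by (simp add: star_form_def)
  ultimately show ?thesis by (simp add: euler_char_def subgraph_on_def)
qed


section \<open>Cyclic presentations\<close>

text \<open>The successor of the last entry is a parameter, so that a circle made of blocks can be
  cut at the block boundaries; \<open>cyc\<close> closes the list up.\<close>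

fun pairs :: "'x list \<Rightarrow> 'x \<Rightarrow> ('x \<times> 'x) list" where
  "pairs [] z = []"
| "pairs (x # xs) z = (x, hd (xs @ [z])) # pairs xs z"

definition cyc :: "'x list \<Rightarrow> ('x \<times> 'x) list" where
  "cyc xs = pairs xs (hd xs)"

lemma pairs_append: "pairs (xs @ ys) z = pairs xs (hd (ys @ [z])) @ pairs ys z"
  by (induction xs) (auto simp: hd_append)

lemma map_fst_pairs [simp]: "map fst (pairs xs z) = xs"
  by (induction xs) auto

lemma snd_pairs: "(x, y) \<in> set (pairs xs z) \<Longrightarrow> y \<in> insert z (set xs)"
  by (induction xs) (auto simp: hd_append split: if_splits)

lemma fst_pairs: "(x, y) \<in> set (pairs xs z) \<Longrightarrow> x \<in> set xs"
  by (metis fst_conv image_eqI list.set_map map_fst_pairs)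

lemma cyc_set:
  assumes "(x, y) \<in> set (cyc xs)"
  shows "x \<in> set xs \<and> y \<in> set xs"
proof -
  have "x \<in> set xs" "y \<in> insert (hd xs) (set xs)"
    using assms fst_pairs snd_pairs unfolding cyc_def by fast+
  then show ?thesis by (cases xs) auto
qed

lemma pairs_const:
  "(\<forall>(x, y) \<in> set (pairs xs z). g y = g x) \<longleftrightarrow> (\<forall>x \<in> set xs. g x = g z)"
proof (induction xs)
  case (Cons x xs)
  have "hd (xs @ [z]) = z \<or> hd (xs @ [z]) \<in> set xs" by (cases xs) auto
  then have "g (hd (xs @ [z])) = g x \<longleftrightarrow> g x = g z" if "\<forall>x \<in> set xs. g x = g z"
    using that by metis
  then show ?case using Cons.IH by (simp only: pairs.simps list.set ball_simps prod.case) blast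
qed simp

text \<open>Going once around the cycle, \<open>g\<close> can change only at the last element.\<close>

lemma cyc_const:
  assumes "distinct xs" "xs \<noteq> []"
  shows "(\<forall>(x, y) \<in> set (cyc xs). g y = (if x = last xs then a (g x) else g x)) \<longleftrightarrow>
    (\<forall>x \<in> set xs. g x = g (last xs)) \<and> a (g (last xs)) = g (last xs)"
proof -
  obtain ys z where xs: "xs = ys @ [z]" using assms(2) by (metis rev_exhaust)
  have z: "x \<noteq> z" if "x \<in> set ys" for x using assms(1) that by (auto simp: xs)
  have "(\<forall>(x, y) \<in> set (pairs ys z). g y = (if x = z then a (g x) else g x)) \<longleftrightarrow>
      (\<forall>(x, y) \<in> set (pairs ys z). g y = g x)"
  proof (rule ball_cong[OF HOL.refl])
    fix q assume "q \<in> set (pairs ys z)"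
    moreover obtain x y where q: "q = (x, y)" by (cases q)
    ultimately have "x \<noteq> z" using z fst_pairs by metis
    then show "(case q of (x, y) \<Rightarrow> g y = (if x = z then a (g x) else g x)) \<longleftrightarrow>
        (case q of (x, y) \<Rightarrow> g y = g x)"
      by (simp add: q)
  qed
  then have "(\<forall>(x, y) \<in> set (cyc xs). g y = (if x = last xs then a (g x) else g x)) \<longleftrightarrow>
      (\<forall>x \<in> set ys. g x = g z) \<and> g (hd xs) = a (g z)"
    by (simp add: cyc_def xs pairs_append pairs_const conj_commute)
  moreover have "hd xs = z \<or> hd xs \<in> set ys" by (cases ys) (auto simp: xs)
  then have "g (hd xs) = g z" if "\<forall>x \<in> set ys. g x = g z"
    using that by blast
  moreover have "last xs = z" "(\<forall>x \<in> set xs. g x = g z) \<longleftrightarrow> (\<forall>x \<in> set ys. g x = g z)"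
    by (auto simp: xs)
  ultimately show ?thesis by (smt (verit))
qed

definition cyc_rels :: "nat list list \<Rightarrow> (nat \<Rightarrow> nat word) \<Rightarrow> nat conj_rel set" where
  "cyc_rels cs u = {(y, u x, x) | x y c. c \<in> set cs \<and> (x, y) \<in> set (cyc c)}"

context group
begin

text \<open>Pull every generator back to the root: \<open>g v\<close> is \<open>f v\<close>
  conjugated by the inverse of \<open>W v\<close>. Then a step from \<open>x\<close> to
  \<open>y\<close> reads \<open>g y = g x\<close>, except for the closing one, which applies
  \<open>S\<close>. By \<open>cyc_const\<close>, \<open>g\<close> is constant with a value fixed by
  \<open>S\<close>; this value is \<open>f r\<close> because \<open>W r\<close> is empty.\<close>

lemma star_model_class:
  assumes f: "f \<in> {..<n} \<rightarrow> carrier G" and st: "star_words n \<rho> W U"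
    and c: "distinct c" "set c = {v. v < n \<and> \<rho> v = r}" "r < n" "\<rho> r = r"
    and S: "S \<in> words {..<n}"
    and u: "\<And>x y. (x, y) \<in> set (cyc c) \<Longrightarrow>
      u x = inv_word (W x) @ (if x = last c then S else []) @ W y @ [(x, Pos), (x, Neg)]"
  shows "(\<forall>(x, y) \<in> set (cyc c). f y = conj_by G (val G f (u x)) (f x)) \<longleftrightarrow>
    (\<forall>v \<in> set c. f v = conj_by G (val G f (W v)) (f r)) \<and> conj_by G (val G f S) (f r) = f r"
proof -
  define g where "g v = conj_by G (inv (val G f (W v))) (f v)" for v
  define a where "a x = conj_by G (val G f S) x" for x
  have r: "r \<in> set c" unfolding c(2) using c(3,4) by simp
  then have ne: "c \<noteq> []" by auto
  have n: "x < n" "W x \<in> words {..<n}" if "x \<in> set c" for x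
    using that c st by (auto simp: star_words_def)
  have fc [simp]: "f x \<in> carrier G" if "x < n" for x using f that by auto
  have wc [simp]: "val G f w \<in> carrier G" if "w \<in> words {..<n}" for w
    by (rule val_closed[OF f that])
  have gc: "g x \<in> carrier G" if "x \<in> set c" for x
    using n[OF that] by (simp add: g_def)
  have fg: "f x = conj_by G (val G f (W x)) (g x)" if "x \<in> set c" for x
    using n[OF that] by (simp add: g_def)
  have W: "W r = []" using st c(3,4) unfolding star_words_def by metis
  have gr: "g r = f r" using c(3) by (simp add: g_def W)
  have rel: "f y = conj_by G (val G f (u x)) (f x) \<longleftrightarrow> g y = (if x = last c then a (g x) else g x)"
    if xy: "(x, y) \<in> set (cyc c)" for x y
  proof -
    have x: "x \<in> set c" and y: "y \<in> set c" using cyc_set[OF xy] by auto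
    define h where "h = (if x = last c then a (g x) else g x)"
    have hc: "h \<in> carrier G" using gc[OF x] S by (cases "x = last c") (simp_all add: h_def a_def)
    have tail: "val G f [(x, Pos), (x, Neg)] = \<one>" using n[OF x] by simp
    have "val G f (u x) = inv (val G f (W x)) \<otimes>
        ((if x = last c then val G f S else \<one>) \<otimes> (val G f (W y) \<otimes> \<one>))"
      using n[OF x] n[OF y] S
      by (simp add: u[OF xy] val_append[OF f] val_inv_word[OF f] tail del: val.simps(2))
    then have "conj_by G (val G f (u x)) (f x) = conj_by G (val G f (W y)) h"
      using n[OF x] n[OF y] S by (cases "x = last c") (simp_all add: h_def a_def g_def)
    then show ?thesis
      using fg[OF y] n[OF y] hc gc[OF y] unfolding h_def[symmetric]
      by (metis conj_by_inv2 wc)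
  qed
  have "(\<forall>(x, y) \<in> set (cyc c). f y = conj_by G (val G f (u x)) (f x)) \<longleftrightarrow>
      (\<forall>(x, y) \<in> set (cyc c). g y = (if x = last c then a (g x) else g x))"
    using rel by blast
  also have "\<dots> \<longleftrightarrow> (\<forall>x \<in> set c. g x = g (last c)) \<and> a (g (last c)) = g (last c)"
    by (rule cyc_const[OF c(1) ne])
  also have "\<dots> \<longleftrightarrow> (\<forall>x \<in> set c. g x = f r) \<and> a (f r) = f r"
  proof -
    have "last c \<in> set c" using ne by simp
    then show ?thesis unfolding gr[symmetric] using r by metis
  qed
  also have "\<dots> \<longleftrightarrow> (\<forall>v \<in> set c. f v = conj_by G (val G f (W v)) (f r)) \<and> a (f r) = f r"
  proof -
    have "g x = f r \<longleftrightarrow> f x = conj_by G (val G f (W x)) (f r)" if "x \<in> set c" for x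
      using n[OF that] c(3) unfolding g_def by (simp add: conj_by_inv_eq_iff)
    then show ?thesis by blast
  qed
  finally show ?thesis by (simp add: a_def)
qed

end

lemma distinct_concat_classes:
  assumes "distinct rts" "distinct xs"
  shows "distinct (concat (map (\<lambda>r. filter (\<lambda>u. \<rho> u = r) xs) rts))"
  using assms by (induction rts) auto

lemma cyclic_form:
  assumes W: "is_wirtinger (n, rs)"
    and euler: "\<And>C. C \<in> components (wirtinger_graph (n, rs)) \<Longrightarrow>
      euler_char (subgraph_on (wirtinger_graph (n, rs)) C) \<in> {0, 1}"
  obtains cs u where "distinct (concat cs)" "set (concat cs) = {..<n}" "[] \<notin> set cs"
    "\<And>v. v < n \<Longrightarrow> u v \<in> words {..<n} \<and> u v \<noteq> []"
    "wirtinger_group (n, rs) \<cong> pres {..<n} (cyc_rels cs u)"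
proof -
  have rs: "set rs \<subseteq> conj_rels {..<n}" using W by fastforce
  then obtain \<rho> V U where sf: "star_form n rs \<rho> V U" using star_form_exists by blast
  then have st: "star_words n \<rho> V U" by (simp add: star_form_def)
  then have st': "\<rho> v < n" "\<rho> (\<rho> v) = \<rho> v" "V (\<rho> v) = []" "V v \<in> words {..<n}" "set (U v) \<subseteq> words {..<n}"
    if "v < n" for v
    using that by (auto simp: star_words_def)
  have U: "length (U (\<rho> v)) \<le> 1" if "v < n" for v
  proof -
    have "{u. u < n \<and> \<rho> u = \<rho> v} \<in> components (wirtinger_graph (n, rs))"
      unfolding component_eq[OF that sf rs, symmetric] components_def
      by (rule quotientI) (simp add: that)
    \<comment> \<open>The only use of the hypothesis on the Euler characteristic: one minus the
      number of loop words is 0 or 1.\<close>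
    from euler[OF this] show ?thesis
      unfolding euler_char_component[OF that sf rs] by auto
  qed
  \<comment> \<open>The only loop word of the component; a tree gets the empty word, which commutes
    with everything.\<close>
  define S where "S r = (case U r of [] \<Rightarrow> [] | s # _ \<Rightarrow> s)" for r
  have S: "S (\<rho> v) \<in> words {..<n}" if "v < n" for v
    using st'(5)[OF st'(1)[OF that]] by (auto simp: S_def split: list.split)
  define cls where "cls r = filter (\<lambda>v. \<rho> v = r) [0..<n]" for r
  define rts where "rts = filter (\<lambda>r. \<rho> r = r) [0..<n]"
  define cs where "cs = map cls rts"
  have set_cls: "set (cls r) = {v. v < n \<and> \<rho> v = r}" for r by (auto simp: cls_def)
  have set_rts: "set rts = {r. r < n \<and> \<rho> r = r}" by (auto simp: rts_def)
  have dist: "distinct (concat cs)"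
    unfolding cs_def cls_def by (rule distinct_concat_classes) (auto simp: rts_def)
  have set_cs: "set (concat cs) = {..<n}"
    using st' by (auto simp: cs_def set_cls set_rts)
  have ne: "[] \<notin> set cs"
  proof
    assume "[] \<in> set cs"
    then obtain r where r: "r \<in> set rts" "[] = cls r" by (auto simp: cs_def)
    have "r \<in> set (cls r)" using r(1) unfolding set_cls set_rts by simp
    then show False using r(2) by (metis empty_iff empty_set)
  qed
  \<comment> \<open>The first components of all consecutive pairs form \<open>concat cs\<close>,
    which is distinct, so the lookup of the successor is unambiguous.\<close>
  define nx where "nx v = the (map_of (concat (map cyc cs)) v)" for v
  have "map fst (concat (map cyc cs)) = concat cs"
    by (simp add: map_concat cyc_def comp_def)
  then have "distinct (map fst (concat (map cyc cs)))" using dist by simp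
  then have nx: "nx x = y" if "c \<in> set cs" "(x, y) \<in> set (cyc c)" for x y c
    unfolding nx_def using that by (subst map_of_is_SomeI[of _ x y]) auto
  \<comment> \<open>Back from \<open>v\<close> to the root, around the loop on the closing step
    only, out to the successor of \<open>v\<close>; the last two letters cancel and merely keep the
    word nonempty.\<close>
  define u where "u v = inv_word (V v) @ (if v = last (cls (\<rho> v)) then S (\<rho> v) else []) @
    V (nx v) @ [(v, Pos), (v, Neg)]" for v
  have nx_less: "nx v < n" if v: "v < n" for v
  proof -
    obtain c where c: "c \<in> set cs" "v \<in> set c" using v set_cs by auto
    then have "v \<in> fst ` set (cyc c)"
      unfolding cyc_def list.set_map[symmetric] map_fst_pairs by simp
    then obtain y where y: "(v, y) \<in> set (cyc c)" by force
    then show ?thesis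
      using nx[OF c(1) y] cyc_set[OF y] c(1) set_cs by auto
  qed
  have uw: "u v \<in> words {..<n} \<and> u v \<noteq> []" if "v < n" for v
    using st'(4)[OF that] st'(4)[OF nx_less[OF that]] S[OF that] that
    unfolding u_def by (cases "v = last (cls (\<rho> v))") simp_all
  have rels: "cyc_rels cs u \<subseteq> conj_rels {..<n}"
  proof
    fix t assume "t \<in> cyc_rels cs u"
    then obtain x y c where t: "t = (y, u x, x)" "c \<in> set cs" "(x, y) \<in> set (cyc c)"
      unfolding cyc_rels_def by blast
    then have "x < n" "y < n" using cyc_set[OF t(3)] set_cs by auto
    then show "t \<in> conj_rels {..<n}" using uw by (simp add: t)
  qed
  have "wirtinger_group (n, rs) \<cong> pres {..<n} (cyc_rels cs u)"
    unfolding wirtinger_group_eq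
  proof (rule pres_cong[OF rs rels])
    fix G :: "nat word set monoid" and f
    assume G: "group G" and f: "f \<in> {..<n} \<rightarrow> carrier G"
    have "model G {..<n} (cyc_rels cs u) f \<longleftrightarrow>
        (\<forall>r \<in> set rts. \<forall>(x, y) \<in> set (cyc (cls r)). f y = conj_by G (val G f (u x)) (f x))"
    proof -
      have "model G {..<n} (cyc_rels cs u) f \<longleftrightarrow>
          (\<forall>x y c. c \<in> set cs \<and> (x, y) \<in> set (cyc c) \<longrightarrow> f y = conj_by G (val G f (u x)) (f x))"
        unfolding model_def cyc_rels_def using f by blast
      then show ?thesis unfolding cs_def by (simp only: list.set_map) blast
    qed
    also have "\<dots> \<longleftrightarrow> (\<forall>r \<in> set rts. (\<forall>v \<in> set (cls r). f v = conj_by G (val G f (V v)) (f r)) \<and>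
        conj_by G (val G f (S r)) (f r) = f r)"
    proof (rule ball_cong[OF HOL.refl])
      fix r assume "r \<in> set rts"
      then have r: "r < n" "\<rho> r = r" "cls r \<in> set cs" by (auto simp: set_rts cs_def)
      show "(\<forall>(x, y) \<in> set (cyc (cls r)). f y = conj_by G (val G f (u x)) (f x)) \<longleftrightarrow>
          (\<forall>v \<in> set (cls r). f v = conj_by G (val G f (V v)) (f r)) \<and>
          conj_by G (val G f (S r)) (f r) = f r"
      proof (rule group.star_model_class[OF G f st _ set_cls r(1,2)])
        show "distinct (cls r)" by (simp add: cls_def)
        show "S r \<in> words {..<n}" using S[OF r(1)] r(2) by simp
        fix x y assume xy: "(x, y) \<in> set (cyc (cls r))"
        then have "\<rho> x = r" using cyc_set[OF xy] by (simp add: set_cls)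
        then show "u x = inv_word (V x) @ (if x = last (cls r) then S r else []) @
            V y @ [(x, Pos), (x, Neg)]"
          unfolding u_def nx[OF r(3) xy] \<open>\<rho> x = r\<close> by simp
      qed
    qed
    also have "\<dots> \<longleftrightarrow> (\<forall>r \<in> set rts. (\<forall>v \<in> set (cls r). f v = conj_by G (val G f (V v)) (f r)) \<and>
        (\<forall>s \<in> set (U r). conj_by G (val G f s) (f r) = f r))"
    proof (intro ball_cong[OF HOL.refl] conj_cong[OF HOL.refl])
      fix r assume "r \<in> set rts"
      then have r: "r < n" "\<rho> r = r" by (auto simp: set_rts)
      have fr: "f r \<in> carrier G" using f r by auto
      show "conj_by G (val G f (S r)) (f r) = f r \<longleftrightarrow>
          (\<forall>s \<in> set (U r). conj_by G (val G f s) (f r) = f r)"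
        using U[OF r(1)] r(2) group.conj_by_one[OF G fr]
        by (cases "U r") (simp_all add: S_def)
    qed
    also have "\<dots> \<longleftrightarrow> star_model G n \<rho> V U f" (is "?L \<longleftrightarrow> _")
    proof
      assume L: ?L
      show "star_model G n \<rho> V U f"
        unfolding star_model_def
      proof (intro allI impI)
        fix v assume "v < n"
        then have "\<rho> v \<in> set rts" "v \<in> set (cls (\<rho> v))"
          using st' by (auto simp: set_rts set_cls)
        then show "f v = conj_by G (val G f (V v)) (f (\<rho> v)) \<and>
            (\<forall>u\<in>set (U (\<rho> v)). conj_by G (val G f u) (f (\<rho> v)) = f (\<rho> v))"
          using L by blast
      qed
    next
      assume sm: "star_model G n \<rho> V U f"
      show ?L
      proof (intro ballI conjI)
        fix r assume "r \<in> set rts"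
        then have r: "r < n" "\<rho> r = r" by (auto simp: set_rts)
        show "f v = conj_by G (val G f (V v)) (f r)" if "v \<in> set (cls r)" for v
          using sm that unfolding star_model_def set_cls by blast
        show "conj_by G (val G f s) (f r) = f r" if "s \<in> set (U r)" for s
          using sm that r unfolding star_model_def by metis
      qed
    qed
    also have "\<dots> \<longleftrightarrow> model G {..<n} (set rs) f"
      using sf G f by (simp add: star_form_def)
    finally show "model G {..<n} (set rs) f \<longleftrightarrow> model G {..<n} (cyc_rels cs u) f" by simp
  qed
  then show thesis
    using that[of cs u] dist set_cs ne uw by blast
qed

section \<open>A Gauss diagram from a cyclic presentation\<close>

fun end_word :: "gauss_diagram \<Rightarrow> endpoint \<Rightarrow> endpoint word" where
  "end_word D (Tail k) = []"
| "end_word D (Head k) = [(Tail k, signs D ! k)]"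

text \<open>A segment is named by the endpoint in which it ends, so relations link consecutive list
  entries and indices modulo the length disappear.\<close>

definition end_rels :: "gauss_diagram \<Rightarrow> endpoint conj_rel set" where
  "end_rels D = {(e', end_word D e, e) | e e' c. c \<in> set (circles D) \<and> (e, e') \<in> set (cyc c)}"

lemma pairs_zip: "pairs xs z = zip xs (tl xs @ [z])"
proof (induction xs)
  case (Cons x xs)
  then show ?case by (cases xs) auto
qed simp

lemma cyc_nth: "set (cyc c) = {(c ! p, c ! (Suc p mod length c)) | p. p < length c}"
proof (cases "c = []")
  case False
  then have "cyc c = zip c (rotate1 c)"
    by (simp add: cyc_def pairs_zip rotate1_hd_tl)
  then show ?thesis
    by (auto simp: set_zip nth_rotate1)
qed (simp add: cyc_def)

lemma (in gauss) relabel_point: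
  assumes s: "s \<in> pointed D"
  shows "relabel (point D) (next_seg D s, passage D (point D s), s) =
    (point D (next_seg D s), end_word D (point D s), point D s)"
  using seg_of_Tail[OF s] by (cases "point D s") (simp_all add: relabel_def)

lemma (in gauss) end_rels_eq: "end_rels D = relabel (point D) ` seg_rels D"
proof -
  have "(\<exists>c. c \<in> set (circles D) \<and> (e, e') \<in> set (cyc c)) \<longleftrightarrow>
      (\<exists>s \<in> pointed D. e = point D s \<and> e' = point D (next_seg D s))" for e e'
    unfolding in_set_conv_nth cyc_nth by (force simp: pointed_def point_def next_seg_def)
  note ex = this
  have "t \<in> end_rels D \<longleftrightarrow> (\<exists>e e'. t = (e', end_word D e, e) \<and>
      (\<exists>c. c \<in> set (circles D) \<and> (e, e') \<in> set (cyc c)))" for t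
    unfolding end_rels_def by blast
  then have "end_rels D = {(point D (next_seg D s), end_word D (point D s), point D s) | s. s \<in> pointed D}"
    unfolding set_eq_iff mem_Collect_eq ex by blast
  also have "\<dots> = relabel (point D) ` seg_rels D"
    unfolding seg_rels_def image_image Setcompr_eq_image
    by (rule image_cong[OF _ relabel_point[symmetric]]) auto
  finally show ?thesis .
qed

text \<open>Without empty circles every segment ends in an endpoint of its own, so
  \<open>point\<close> merely renames the generators.\<close>

lemma (in gauss) gauss_group_endpoints:
  assumes "[] \<notin> set (circles D)"
  shows "gauss_group D \<cong>
      pres (Tail ` {..<length (signs D)} \<union> Head ` {..<length (signs D)}) (end_rels D)"
    "end_rels D \<subseteq> conj_rels (Tail ` {..<length (signs D)} \<union> Head ` {..<length (signs D)})"
proof -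
  have "0 < length (circles D ! i)" if "i < length (circles D)" for i
    using assms nth_mem[OF that] by auto
  then have segs: "segments D = pointed D"
    by (auto simp: segments_def pointed_def less_max_iff_disj)
  then have inj: "inj_on (point D) (segments D)" using inj_point by simp
  have E: "point D ` segments D = Tail ` {..<length (signs D)} \<union> Head ` {..<length (signs D)}"
    using segs point_image by simp
  show "gauss_group D \<cong>
      pres (Tail ` {..<length (signs D)} \<union> Head ` {..<length (signs D)}) (end_rels D)"
    using iso_trans[OF gauss_group_iso pres_relabel[OF seg_rels inj]] unfolding end_rels_eq E .
  show "end_rels D \<subseteq> conj_rels (Tail ` {..<length (signs D)} \<union> Head ` {..<length (signs D)})"
    using relabel_conj_rels[OF seg_rels, of "point D"] unfolding end_rels_eq E .
qed

lemma pairs_upt: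
  "pairs (map h [0..<l]) z = map (\<lambda>t. (h t, if Suc t < l then h (Suc t) else z)) [0..<l]"
  by (induction l arbitrary: z) (auto simp: pairs_append intro!: arg_cong[of _ _ h])

text \<open>As blocks are nonempty, the entry that follows a block is the first entry of the next
  block.\<close>

lemma pairs_concat:
  assumes "\<And>v. v \<in> set vs \<Longrightarrow> B v \<noteq> []"
  shows "pairs (concat (map B vs)) (hd (B z)) =
    concat (map (\<lambda>(v, v'). pairs (B v) (hd (B v'))) (pairs vs z))"
  using assms
proof (induction vs)
  case (Cons v vs)
  have "hd (concat (map B vs) @ [hd (B z)]) = hd (B (hd (vs @ [z])))"
    using Cons.prems by (cases vs) auto
  then show ?case using Cons by (simp add: pairs_append)
qed simp

lemma cyc_concat:
  assumes "\<And>v. v \<in> set vs \<Longrightarrow> B v \<noteq> []"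
  shows "set (cyc (concat (map B vs))) = (\<Union>(v, v') \<in> set (cyc vs). set (pairs (B v) (hd (B v'))))"
proof (cases vs)
  case (Cons v vs')
  then have "hd (concat (map B vs)) = hd (B (hd vs))" using assms by simp
  moreover have "pairs (concat (map B vs)) (hd (B (hd vs))) =
      concat (map (\<lambda>(v, v'). pairs (B v) (hd (B v'))) (pairs vs (hd vs)))"
    using assms by (rule pairs_concat)
  ultimately show ?thesis unfolding cyc_def by (simp add: split_beta)
qed (simp add: cyc_def)

text \<open>\<open>f\<close> recovers from an entry the block that contains it, so different blocks
  share no entry.\<close>

lemma distinct_concat_map:
  assumes "distinct xs" "\<And>x. x \<in> set xs \<Longrightarrow> distinct (B x)"
    and "\<And>x y. x \<in> set xs \<Longrightarrow> y \<in> set (B x) \<Longrightarrow> f y = x"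
  shows "distinct (concat (map B xs))"
  using assms
proof (induction xs)
  case (Cons x xs)
  have "y \<notin> set (concat (map B xs))" if y: "y \<in> set (B x)" for y
  proof
    assume "y \<in> set (concat (map B xs))"
    then obtain x' where x': "x' \<in> set xs" "y \<in> set (B x')" by auto
    have "f y = x" "f y = x'" using Cons.prems(3) x' y by (meson list.set_intros)+
    then show False using x' Cons.prems(1) by auto
  qed
  then show ?case using Cons by auto
qed simp

section \<open>Construction of the diagram\<close>

locale cyclic_presentation =
  fixes n :: nat and cs :: "nat list list" and u :: "nat \<Rightarrow> nat word"
    and k :: nat and num :: "nat \<times> nat \<Rightarrow> nat"
  assumes n: "1 \<le> n"
    and distinct_cs: "distinct (concat cs)" and set_cs: "set (concat cs) = {..<n}" and Nil_cs: "[] \<notin> set cs"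
    and u: "v < n \<Longrightarrow> u v \<in> words {..<n}" "v < n \<Longrightarrow> u v \<noteq> []"
    and num: "bij_betw num (SIGMA v:{..<n}. {..<length (u v)}) {..<k}"
begin

text \<open>The letter \<open>t\<close> of the word \<open>u v\<close> becomes the arrow \<open>num (v, t)\<close>.  Its head lies on the
  block of \<open>v\<close> and its tail at the beginning of the block of the generator in that letter.\<close>

definition arr :: "nat \<Rightarrow> nat \<times> nat" where
  "arr = inv_into (SIGMA v:{..<n}. {..<length (u v)}) num"

definition letter :: "nat \<Rightarrow> nat \<times> sign" where
  "letter m = u (fst (arr m)) ! snd (arr m)"

definition tails :: "nat \<Rightarrow> endpoint list" where
  "tails v = map Tail (filter (\<lambda>m. fst (letter m) = v) [0..<k])"

definition heads :: "nat \<Rightarrow> endpoint list" where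
  "heads v = map (\<lambda>t. Head (num (v, t))) [0..<length (u v)]"

text \<open>With the tails ahead of the heads, every tail of the block lies on the arc that ends at
  its first head. This arc carries \<open>v\<close> before any conjugation, so a letter
  \<open>v\<close> acts by the generator itself.\<close>

definition block :: "nat \<Rightarrow> endpoint list" where
  "block v = tails v @ heads v"

definition diagram :: gauss_diagram where
  "diagram = \<lparr>circles = map (\<lambda>c. concat (map block c)) cs, signs = map (\<lambda>m. snd (letter m)) [0..<k]\<rparr>"

lemma num_less: "v < n \<Longrightarrow> t < length (u v) \<Longrightarrow> num (v, t) < k"
  using bij_betwE[OF num] by auto

lemma arr_num [simp]: "v < n \<Longrightarrow> t < length (u v) \<Longrightarrow> arr (num (v, t)) = (v, t)"
  using num by (simp add: arr_def bij_betw_def)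

lemma arr_props:
  assumes "m < k"
  obtains v t where "arr m = (v, t)" "m = num (v, t)" "v < n" "t < length (u v)"
proof -
  have m: "m \<in> num ` (SIGMA v:{..<n}. {..<length (u v)})"
    using num assms by (simp add: bij_betw_def)
  obtain v t where vt: "arr m = (v, t)" by (cases "arr m")
  have "arr m \<in> (SIGMA v:{..<n}. {..<length (u v)})" "num (arr m) = m"
    unfolding arr_def using inv_into_into[OF m] f_inv_into_f[OF m] by auto
  then show thesis using that vt by auto
qed

lemma letter_num [simp]: "v < n \<Longrightarrow> t < length (u v) \<Longrightarrow> letter (num (v, t)) = u v ! t"
  by (simp add: letter_def)

lemma letter_less: "m < k \<Longrightarrow> fst (letter m) < n"
proof -
  assume "m < k"
  then obtain v t where "m = num (v, t)" "v < n" "t < length (u v)" by (rule arr_props)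
  then show ?thesis using u(1)[of v] nth_mem[of t "u v"] by (auto simp: words_iff)
qed

lemma signs_diagram [simp]: "length (signs diagram) = k" "m < k \<Longrightarrow> signs diagram ! m = snd (letter m)"
  by (simp_all add: diagram_def)

lemma heads_nonempty: "v < n \<Longrightarrow> heads v \<noteq> []"
  using u(2) by (simp add: heads_def)

lemma block_nonempty: "v < n \<Longrightarrow> block v \<noteq> []"
  using heads_nonempty by (simp add: block_def)

lemma set_block:
  "v < n \<Longrightarrow> set (block v) = Tail ` {m. m < k \<and> fst (letter m) = v} \<union>
     (\<lambda>t. Head (num (v, t))) ` {..<length (u v)}"
  by (auto simp: block_def tails_def heads_def)

definition owner :: "endpoint \<Rightarrow> nat" where
  "owner e = (case e of Tail m \<Rightarrow> fst (letter m) | Head m \<Rightarrow> fst (arr m))"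

lemma distinct_block: "v < n \<Longrightarrow> distinct (block v)"
proof -
  assume v: "v < n"
  have "inj_on (\<lambda>t. Head (num (v, t))) {..<length (u v)}"
  proof (rule inj_onI)
    fix t t' assume t: "t \<in> {..<length (u v)}" "t' \<in> {..<length (u v)}"
      and "Head (num (v, t)) = Head (num (v, t'))"
    then have "arr (num (v, t)) = arr (num (v, t'))" by simp
    then show "t = t'" using t v by simp
  qed
  then have "distinct (heads v)" by (simp add: heads_def distinct_map atLeast0LessThan)
  moreover have "inj_on Tail A" for A by (simp add: inj_on_def)
  then have "distinct (tails v)" by (simp add: tails_def distinct_map)
  ultimately show ?thesis by (auto simp: block_def tails_def heads_def)
qed

lemma concat_circles: "concat (circles diagram) = concat (map block (concat cs))"
  by (simp add: diagram_def map_concat comp_def) (induction cs; simp)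

lemma is_gauss_diagram: "is_gauss_diagram diagram"
  unfolding is_gauss_diagram_def concat_circles
proof (intro conjI)
  have "0 \<in> set (concat cs)" unfolding set_cs using n by simp
  then show "circles diagram \<noteq> []" by (auto simp: diagram_def)
  show "distinct (concat (map block (concat cs)))"
  proof (rule distinct_concat_map[OF distinct_cs])
    fix x assume "x \<in> set (concat cs)"
    then have x: "x < n" using set_cs by auto
    then show "distinct (block x)" by (rule distinct_block)
    show "owner e = x" if "e \<in> set (block x)" for e
      using that x unfolding set_block[OF x] by (auto simp: owner_def)
  qed
  have "(\<Union>v<n. set (block v)) = Tail ` {..<k} \<union> Head ` {..<k}"
  proof (intro subset_antisym subsetI)
    fix e assume "e \<in> (\<Union>v<n. set (block v))"
    then obtain v where "v < n" "e \<in> set (block v)" by auto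
    then show "e \<in> Tail ` {..<k} \<union> Head ` {..<k}"
      using num_less by (auto simp: set_block)
  next
    fix e assume e: "e \<in> Tail ` {..<k} \<union> Head ` {..<k}"
    show "e \<in> (\<Union>v<n. set (block v))"
    proof (cases e)
      case (Tail m)
      then have "m < k" using e by auto
      then show ?thesis using Tail letter_less[of m] set_block by auto
    next
      case (Head m)
      then have "m < k" using e by auto
      then obtain v t where "m = num (v, t)" "v < n" "t < length (u v)" by (rule arr_props)
      then show ?thesis using Head set_block by auto
    qed
  qed
  moreover have "set (concat (map block (concat cs))) = (\<Union>v \<in> set (concat cs). set (block v))"
    by simp
  ultimately show "set (concat (map block (concat cs))) =
      Tail ` {..<length (signs diagram)} \<union> Head ` {..<length (signs diagram)}"
    unfolding set_cs signs_diagram by simp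
qed

sublocale gauss diagram
  by unfold_locales (rule is_gauss_diagram)

abbreviation "endpoints \<equiv> Tail ` {..<k} \<union> Head ` {..<k}"

lemma circles_nonempty: "[] \<notin> set (circles diagram)"
proof
  assume "[] \<in> set (circles diagram)"
  then obtain c where c: "c \<in> set cs" "concat (map block c) = []" by (auto simp: diagram_def)
  then have "hd c \<in> set c" using Nil_cs by (metis hd_in_set)
  then obtain v where "v \<in> set c" by blast
  moreover from this have "v < n" using c set_cs by auto
  ultimately show False using c block_nonempty by auto
qed

lemma end_rels_iff:
  "(\<forall>(e', w, e) \<in> end_rels diagram. R e' w e) \<longleftrightarrow>
    (\<forall>c \<in> set cs. \<forall>(v, v') \<in> set (cyc c). \<forall>(e, e') \<in> set (pairs (block v) (hd (block v'))).
       R e' (end_word diagram e) e)"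
proof -
  have "set (cyc (concat (map block c))) = (\<Union>(v, v') \<in> set (cyc c). set (pairs (block v) (hd (block v'))))"
    if "c \<in> set cs" for c
    using that set_cs by (intro cyc_concat block_nonempty) auto
  then have "(\<forall>(e', w, e) \<in> end_rels diagram. R e' w e) \<longleftrightarrow>
      (\<forall>c \<in> set cs. \<forall>(e, e') \<in> (\<Union>(v, v') \<in> set (cyc c). set (pairs (block v) (hd (block v')))).
         R e' (end_word diagram e) e)"
    unfolding end_rels_def by (simp add: diagram_def) blast
  then show ?thesis by (simp add: split_beta)
qed

text \<open>Tails have the empty word, so their relations collapse to a chain of equalities up to
  the first head; a head conjugates by the signed value at the tail of its arrow. The entry
  \<open>z\<close> is the one after the block.\<close>

lemma block_rels_iff:
  assumes G: "group G" and F: "F \<in> endpoints \<rightarrow> carrier G" and v: "v < n"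
  shows "(\<forall>(e, e') \<in> set (pairs (block v) z). F e' = conj_by G (val G F (end_word diagram e)) (F e)) \<longleftrightarrow>
    (\<forall>m<k. fst (letter m) = v \<longrightarrow> F (Tail m) = F (Head (num (v, 0)))) \<and>
    (\<forall>t<length (u v). F (if Suc t < length (u v) then Head (num (v, Suc t)) else z) =
      conj_by G (signed G (snd (u v ! t)) (F (Tail (num (v, t))))) (F (Head (num (v, t)))))"
    (is "?L \<longleftrightarrow> ?T \<and> ?H")
proof -
  interpret group G by (rule G)
  have "hd (heads v @ [z]) = Head (num (v, 0))"
    using u(2)[OF v] by (simp add: heads_def hd_map hd_append)
  then have pairs: "pairs (block v) z = pairs (tails v) (Head (num (v, 0))) @ pairs (heads v) z"
    by (simp add: block_def pairs_append)
  have "(\<forall>(e, e') \<in> set (pairs (tails v) z'). F e' = conj_by G (val G F (end_word diagram e)) (F e)) \<longleftrightarrow>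
      (\<forall>(e, e') \<in> set (pairs (tails v) z'). F e' = F e)" for z'
  proof (rule ball_cong[OF HOL.refl])
    fix q assume q: "q \<in> set (pairs (tails v) z')"
    obtain e e' where q': "q = (e, e')" by (cases q)
    then have "e \<in> set (tails v)" using q fst_pairs by metis
    then obtain m where m: "e = Tail m" "m < k" by (auto simp: tails_def)
    then have "F e \<in> carrier G" using F by auto
    then show "(case q of (e, e') \<Rightarrow> F e' = conj_by G (val G F (end_word diagram e)) (F e)) \<longleftrightarrow>
        (case q of (e, e') \<Rightarrow> F e' = F e)"
      by (simp add: q' m)
  qed
  then have T: "(\<forall>(e, e') \<in> set (pairs (tails v) (Head (num (v, 0)))).
      F e' = conj_by G (val G F (end_word diagram e)) (F e)) \<longleftrightarrow> ?T"
    unfolding pairs_const by (auto simp: tails_def)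
  have "(\<forall>(e, e') \<in> set (pairs (heads v) z). F e' = conj_by G (val G F (end_word diagram e)) (F e)) \<longleftrightarrow>
      (\<forall>t<length (u v). F (if Suc t < length (u v) then Head (num (v, Suc t)) else z) =
        conj_by G (val G F (end_word diagram (Head (num (v, t))))) (F (Head (num (v, t)))))"
    unfolding heads_def pairs_upt by (simp only: set_map set_upt ball_simps prod.case atLeast0LessThan) auto
  also have "\<dots> \<longleftrightarrow> ?H"
  proof (intro all_cong)
    fix t assume t: "t < length (u v)"
    have "F (Tail (num (v, t))) \<in> carrier G" using F num_less[OF v t] by auto
    then have "val G F (end_word diagram (Head (num (v, t)))) =
        signed G (snd (u v ! t)) (F (Tail (num (v, t))))"
      using v t num_less[OF v t] by simp
    then show "F (if Suc t < length (u v) then Head (num (v, Suc t)) else z) =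
        conj_by G (val G F (end_word diagram (Head (num (v, t))))) (F (Head (num (v, t)))) \<longleftrightarrow>
      F (if Suc t < length (u v) then Head (num (v, Suc t)) else z) =
        conj_by G (signed G (snd (u v ! t)) (F (Tail (num (v, t))))) (F (Head (num (v, t))))"
      by simp
  qed
  finally have H: "(\<forall>(e, e') \<in> set (pairs (heads v) z).
      F e' = conj_by G (val G F (end_word diagram e)) (F e)) \<longleftrightarrow> ?H" .
  show ?thesis
    unfolding pairs set_append ball_Un T H by (rule HOL.refl)
qed

text \<open>A block starts with a tail if some letter uses \<open>v\<close>, else with its first
  head. Either way its first segment lies on the arc of \<open>v\<close>, so the first entry can
  stand for the generator \<open>v\<close>.\<close>

lemma hd_block:
  assumes "v < n"
  obtains "hd (block v) = Head (num (v, 0))" |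
    m where "m < k" "fst (letter m) = v" "hd (block v) = Tail m"
proof (cases "tails v")
  case Nil
  then have "hd (block v) = Head (num (v, 0))"
    using u(2)[OF assms] by (simp add: block_def heads_def hd_map)
  then show ?thesis using that by blast
next
  case (Cons e es)
  then have "e \<in> set (tails v)" by simp
  then obtain m where "m < k" "fst (letter m) = v" "e = Tail m" by (auto simp: tails_def)
  then show ?thesis using that Cons by (simp add: block_def)
qed

lemma hd_block_endpoints: "v < n \<Longrightarrow> hd (block v) \<in> endpoints"
proof -
  assume v: "v < n"
  have "num (v, 0) < k" using num_less[OF v] u(2)[OF v] by simp
  then show ?thesis by (cases rule: hd_block[OF v]) auto
qed

section \<open>Correspondence between models of the cycles and of the diagram\<close>

text \<open>The element that the segment ending in \<open>e\<close> should carry, in terms of the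
  original generators. This segment stops short of the head of letter \<open>t\<close>, so only the
  first \<open>t\<close> letters have acted.\<close>

definition trace :: "endpoint \<Rightarrow> nat word" where
  "trace e = (case e of Tail m \<Rightarrow> [(fst (letter m), Pos)]
    | Head m \<Rightarrow> (case arr m of (v, t) \<Rightarrow> inv_word (take t (u v)) @ [(v, Pos)] @ take t (u v)))"

lemma take_u: "v < n \<Longrightarrow> take t (u v) \<in> words {..<n}"
  using u(1)[of v] set_take_subset[of t "u v"] by (auto simp: words_iff)

lemma trace_words: "e \<in> endpoints \<Longrightarrow> trace e \<in> words {..<n}"
proof (cases e)
  case (Tail m)
  moreover assume "e \<in> endpoints"
  ultimately show ?thesis using letter_less by (auto simp: trace_def)
next
  case (Head m)
  moreover assume "e \<in> endpoints"
  ultimately have "m < k" by auto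
  then obtain v t where "arr m = (v, t)" "v < n" by (rule arr_props)
  then show ?thesis using take_u by (simp add: trace_def Head)
qed

lemma
  assumes G: "group G" and g: "g \<in> {..<n} \<rightarrow> carrier G"
  shows val_trace_Tail: "m < k \<Longrightarrow> val G g (trace (Tail m)) = g (fst (letter m))"
    and val_trace_Head: "v < n \<Longrightarrow> t < length (u v) \<Longrightarrow>
      val G g (trace (Head (num (v, t)))) = conj_by G (val G g (take t (u v))) (g v)"
proof -
  interpret group G by (rule G)
  show "val G g (trace (Tail m)) = g (fst (letter m))" if "m < k"
    unfolding trace_def endpoint.case using g letter_less[OF that] by (intro val_single) auto
  show "val G g (trace (Head (num (v, t)))) = conj_by G (val G g (take t (u v))) (g v)"
    if "v < n" "t < length (u v)"
    unfolding trace_def endpoint.case arr_num[OF that] prod.case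
    using that take_u by (intro val_conj_word[OF g]) auto
qed

lemma val_take_Suc:
  assumes G: "group G" and g: "g \<in> {..<n} \<rightarrow> carrier G" and v: "v < n" "t < length (u v)" and x: "x \<in> carrier G"
  shows "conj_by G (val G g (take (Suc t) (u v))) x =
    conj_by G (signed G (snd (u v ! t)) (g (fst (u v ! t)))) (conj_by G (val G g (take t (u v))) x)"
proof -
  interpret group G by (rule G)
  have l: "fst (u v ! t) < n" using u(1)[OF v(1)] nth_mem[OF v(2)] by (auto simp: words_iff)
  then have c: "g (fst (u v ! t)) \<in> carrier G" using g by auto
  have "val G g (take (Suc t) (u v)) = val G g (take t (u v)) \<otimes>\<^bsub>G\<^esub> val G g [u v ! t]"
    unfolding take_Suc_conv_app_nth[OF v(2)] using l take_u[OF v(1)]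
    by (intro val_append[OF g]) auto
  then show ?thesis
    using c x val_closed[OF g take_u[OF v(1)]] by simp
qed

text \<open>Crossing the head of letter \<open>t\<close> conjugates by that letter. After the whole
  block, \<open>g v\<close> has been conjugated by \<open>u v\<close>, and the cyclic relation
  identifies the result with the next generator.\<close>

lemma model_of_cyc:
  assumes G: "group G" and m: "model G {..<n} (cyc_rels cs u) g"
  shows "model G endpoints (end_rels diagram) (\<lambda>e. val G g (trace e))"
    and "v < n \<Longrightarrow> val G g (trace (hd (block v))) = g v"
proof -
  interpret group G by (rule G)
  have g: "g \<in> {..<n} \<rightarrow> carrier G" using m by (simp add: model_def)
  have gc: "g v \<in> carrier G" if "v < n" for v using g that by auto
  have hd: "val G g (trace (hd (block v))) = g v" if v: "v < n" for v
  proof (cases rule: hd_block[OF v])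
    case 1
    show ?thesis
      unfolding 1 using val_trace_Head[OF G g v, of 0] u(2)[OF v] gc[OF v] by simp
  next
    case (2 m)
    then show ?thesis using val_trace_Tail[OF G g, of m] by simp
  qed
  then show "v < n \<Longrightarrow> val G g (trace (hd (block v))) = g v" .
  let ?F = "\<lambda>e. val G g (trace e)"
  have F: "?F \<in> endpoints \<rightarrow> carrier G"
    using trace_words val_closed[OF g] by blast
  show "model G endpoints (end_rels diagram) ?F"
    unfolding model_def end_rels_iff
  proof (intro conjI F ballI, clarify)
    fix c v v' e e'
    assume c: "c \<in> set cs" "(v, v') \<in> set (cyc c)"
      and e: "(e, e') \<in> set (pairs (block v) (hd (block v')))"
    have v: "v < n" "v' < n" using cyc_set[OF c(2)] c(1) set_cs by auto
    have gv': "g v' = conj_by G (val G g (u v)) (g v)"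
      using m c unfolding model_def cyc_rels_def by blast
    have H0: "?F (Head (num (v, 0))) = g v"
      using val_trace_Head[OF G g v(1), of 0] u(2)[OF v(1)] gc[OF v(1)] by simp
    have "\<forall>(e, e') \<in> set (pairs (block v) (hd (block v'))).
        ?F e' = conj_by G (val G ?F (end_word diagram e)) (?F e)"
      unfolding block_rels_iff[OF G F v(1)] H0
    proof (intro conjI allI impI)
      show "?F (Tail m) = g v" if "m < k" "fst (letter m) = v" for m
        using val_trace_Tail[OF G g that(1)] that(2) by simp
      fix t assume t: "t < length (u v)"
      have "?F (if Suc t < length (u v) then Head (num (v, Suc t)) else hd (block v')) =
          conj_by G (val G g (take (Suc t) (u v))) (g v)"
      proof (cases "Suc t < length (u v)")
        case True
        then show ?thesis using val_trace_Head[OF G g v(1) True] by simp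
      next
        \<comment> \<open>Past the last head the word is used up and the next block begins, so here
          the cyclic relation from \<open>v\<close> to \<open>v'\<close> enters.\<close>
        case False
        then have "take (Suc t) (u v) = u v" by simp
        then show ?thesis using False hd[OF v(2)] gv' by simp
      qed
      also have "\<dots> = conj_by G (signed G (snd (u v ! t)) (g (fst (u v ! t))))
          (conj_by G (val G g (take t (u v))) (g v))"
        by (rule val_take_Suc[OF G g v(1) t gc[OF v(1)]])
      also have "\<dots> = conj_by G (signed G (snd (u v ! t)) (?F (Tail (num (v, t)))))
          (?F (Head (num (v, t))))"
        using val_trace_Tail[OF G g num_less[OF v(1) t]] val_trace_Head[OF G g v(1) t] v(1) t by simp
      finally show "?F (if Suc t < length (u v) then Head (num (v, Suc t)) else hd (block v')) =
          conj_by G (signed G (snd (u v ! t)) (?F (Tail (num (v, t))))) (?F (Head (num (v, t))))" .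
    qed
    then show "?F e' = conj_by G (val G ?F (end_word diagram e)) (?F e)"
      using e by blast
  qed
qed

text \<open>Generators are read off at the starts of the blocks. All tails of a block carry this
  value, so each head conjugates by its letter, and an induction along the heads recovers
  \<open>F\<close> from \<open>g\<close>.\<close>

lemma model_of_endpoints:
  assumes G: "group G" and m: "model G endpoints (end_rels diagram) F"
  defines "g \<equiv> \<lambda>v. F (hd (block v))"
  shows "model G {..<n} (cyc_rels cs u) g" and "e \<in> endpoints \<Longrightarrow> val G g (trace e) = F e"
proof -
  interpret group G by (rule G)
  have F: "F \<in> endpoints \<rightarrow> carrier G" using m by (simp add: model_def)
  have gc: "g v \<in> carrier G" if "v < n" for v
    using F hd_block_endpoints[OF that] by (auto simp: g_def)
  then have g: "g \<in> {..<n} \<rightarrow> carrier G" by auto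
  have block: "(\<forall>m<k. fst (letter m) = v \<longrightarrow> F (Tail m) = F (Head (num (v, 0)))) \<and>
      (\<forall>t<length (u v). F (if Suc t < length (u v) then Head (num (v, Suc t)) else hd (block v')) =
        conj_by G (signed G (snd (u v ! t)) (F (Tail (num (v, t))))) (F (Head (num (v, t)))))"
    if c: "c \<in> set cs" "(v, v') \<in> set (cyc c)" for c v v'
  proof -
    have v: "v < n" using cyc_set[OF c(2)] c(1) set_cs by auto
    have "\<forall>(e, e') \<in> set (pairs (block v) (hd (block v'))).
        F e' = conj_by G (val G F (end_word diagram e)) (F e)"
      using conjunct2[OF m[unfolded model_def end_rels_iff], THEN bspec, OF c(1), THEN bspec, OF c(2)]
      unfolding prod.case .
    then show ?thesis unfolding block_rels_iff[OF G F v] .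
  qed
  have next_ex: "\<exists>c v'. c \<in> set cs \<and> (v, v') \<in> set (cyc c)" if "v < n" for v
  proof -
    have "v \<in> set (concat cs)" using that set_cs by simp
    then obtain c where c: "c \<in> set cs" "v \<in> set c" by auto
    then have "v \<in> fst ` set (cyc c)"
      unfolding cyc_def list.set_map[symmetric] map_fst_pairs by simp
    then show ?thesis using c(1) by force
  qed
  have tail: "F (Tail m) = F (Head (num (v, 0)))" if "m < k" "fst (letter m) = v" for m v
    using next_ex[OF letter_less[OF that(1)]] block that by metis
  have H0: "F (Head (num (v, 0))) = g v" if "v < n" for v
    by (cases rule: hd_block[OF that]) (simp_all add: g_def tail)
  have gT: "F (Tail m) = g (fst (letter m))" if "m < k" for m
    using tail[OF that HOL.refl] H0[OF letter_less[OF that]] by simp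
  \<comment> \<open>For \<open>t\<close> below the length this is the value at a head, as the second
    claim needs; for \<open>t\<close> equal to the length it is the cyclic relation, as the first
    claim needs.\<close>
  have walk: "F (if t < length (u v) then Head (num (v, t)) else hd (block v')) =
      conj_by G (val G g (take t (u v))) (g v)"
    if c: "c \<in> set cs" "(v, v') \<in> set (cyc c)" and "t \<le> length (u v)" for c v v' t
    using that(3)
  proof (induction t)
    case 0
    have "v < n" using cyc_set[OF c(2)] c(1) set_cs by auto
    then show ?case using u(2) H0 gc by simp
  next
    case (Suc t)
    then have t: "t < length (u v)" by simp
    have v: "v < n" using cyc_set[OF c(2)] c(1) set_cs by auto
    have "F (if Suc t < length (u v) then Head (num (v, Suc t)) else hd (block v')) =
        conj_by G (signed G (snd (u v ! t)) (F (Tail (num (v, t))))) (F (Head (num (v, t))))"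
      using block[OF c] t by blast
    also have "F (Tail (num (v, t))) = g (fst (u v ! t))"
      using gT[OF num_less[OF v t]] v t by simp
    also have "F (Head (num (v, t))) = conj_by G (val G g (take t (u v))) (g v)"
      using Suc.IH t by simp
    also have "conj_by G (signed G (snd (u v ! t)) (g (fst (u v ! t))))
        (conj_by G (val G g (take t (u v))) (g v)) = conj_by G (val G g (take (Suc t) (u v))) (g v)"
      by (rule val_take_Suc[OF G g v t gc[OF v], symmetric])
    finally show ?case .
  qed
  show "model G {..<n} (cyc_rels cs u) g"
    unfolding model_def
  proof (intro conjI g ballI)
    fix q assume "q \<in> cyc_rels cs u"
    then obtain x y c where q: "q = (y, u x, x)" and c: "c \<in> set cs" "(x, y) \<in> set (cyc c)"
      unfolding cyc_rels_def by blast
    show "case q of (c, w, b) \<Rightarrow> g c = conj_by G (val G g w) (g b)"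
      using walk[OF c, of "length (u x)"] by (simp add: q g_def)
  qed
  show "val G g (trace e) = F e" if e: "e \<in> endpoints"
  proof (cases e)
    case (Tail m)
    then have "m < k" using e by auto
    then show ?thesis unfolding Tail val_trace_Tail[OF G g \<open>m < k\<close>] using gT by simp
  next
    case (Head m)
    then have "m < k" using e by auto
    then obtain v t where vt: "m = num (v, t)" "v < n" "t < length (u v)" by (rule arr_props)
    obtain c v' where c: "c \<in> set cs" "(v, v') \<in> set (cyc c)" using next_ex[OF vt(2)] by blast
    show ?thesis
      using walk[OF c, of t] vt(3) unfolding Head vt(1) val_trace_Head[OF G g vt(2,3)] by simp
  qed
qed

text \<open>The substitutions are the first entry of a block for a generator and the trace for an
  endpoint; \<open>model_of_cyc\<close> and \<open>model_of_endpoints\<close> show that they are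
  inverse to each other on models.\<close>

lemma diagram_group_iso: "pres {..<n} (cyc_rels cs u) \<cong> gauss_group diagram"
proof -
  have ends: "end_rels diagram \<subseteq> conj_rels endpoints"
    and iso: "gauss_group diagram \<cong> pres endpoints (end_rels diagram)"
    using gauss_group_endpoints[OF circles_nonempty] by simp_all
  have rels: "cyc_rels cs u \<subseteq> conj_rels {..<n}"
  proof
    fix q assume "q \<in> cyc_rels cs u"
    then obtain x y c where q: "q = (y, u x, x)" and c: "c \<in> set cs" "(x, y) \<in> set (cyc c)"
      unfolding cyc_rels_def by blast
    then have "x < n" "y < n" using cyc_set[OF c(2)] set_cs by auto
    then show "q \<in> conj_rels {..<n}" using u(1) by (simp add: q)
  qed
  have "pres {..<n} (cyc_rels cs u) \<cong> pres endpoints (end_rels diagram)"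
  proof (rule pres_isoI[OF rels ends, where \<phi> = "\<lambda>v. [(hd (block v), Pos)]" and \<psi> = trace])
    show "[(hd (block v), Pos)] \<in> words endpoints" if "v \<in> {..<n}" for v
      using hd_block_endpoints that by simp
    show "trace e \<in> words {..<n}" if "e \<in> endpoints" for e
      using trace_words that .
  next
    fix G :: "nat word set monoid" and f
    assume G: "group G" and f: "model G {..<n} (cyc_rels cs u) f"
    interpret group G by (rule G)
    have "val G (\<lambda>e. val G f (trace e)) [(hd (block v), Pos)] = f v" if "v < n" for v
    proof -
      have "f v \<in> carrier G" using f that by (auto simp: model_def)
      then show ?thesis
        using val_single[of "\<lambda>e. val G f (trace e)" "hd (block v)"] model_of_cyc(2)[OF G f that] by metis
    qed
    then show "model G endpoints (end_rels diagram) (\<lambda>e. val G f (trace e)) \<and>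
        (\<forall>v\<in>{..<n}. val G (\<lambda>e. val G f (trace e)) [(hd (block v), Pos)] = f v)"
      using model_of_cyc(1)[OF G f] by blast
  next
    fix G :: "endpoint word set monoid" and f
    assume G: "group G" and f: "model G endpoints (end_rels diagram) f"
    interpret group G by (rule G)
    have v: "f (hd (block v)) = val G f [(hd (block v), Pos)]" if "v \<in> {..<n}" for v
    proof (rule val_single[symmetric])
      show "f (hd (block v)) \<in> carrier G"
        using f hd_block_endpoints[of v] that by (auto simp: model_def)
    qed
    have "val G (\<lambda>v. val G f [(hd (block v), Pos)]) (trace e) = f e" if "e \<in> endpoints" for e
      using val_cong[where f = "\<lambda>v. f (hd (block v))" and G = G, OF v trace_words[OF that]]
        model_of_endpoints(2)[OF G f that] by simp
    moreover have "model G {..<n} (cyc_rels cs u) (\<lambda>v. val G f [(hd (block v), Pos)])"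
      by (rule model_cong[OF rels v model_of_endpoints(1)[OF G f]])
    ultimately show "model G {..<n} (cyc_rels cs u) (\<lambda>v. val G f [(hd (block v), Pos)]) \<and>
        (\<forall>e\<in>endpoints. val G (\<lambda>v. val G f [(hd (block v), Pos)]) (trace e) = f e)"
      by blast
  qed
  then show ?thesis
    using group.iso_sym[OF _ iso] iso_trans group_presented_group unfolding gauss_group_def by blast
qed

end

section \<open>Assembly of the two directions\<close>

lemma gauss_of_wirtinger:
  assumes W: "is_wirtinger W"
    and euler: "\<And>C. C \<in> components (wirtinger_graph W) \<Longrightarrow>
      euler_char (subgraph_on (wirtinger_graph W) C) \<in> {0, 1}"
  obtains D where "is_gauss_diagram D" "wirtinger_group W \<cong> gauss_group D"
proof -
  obtain n rs where nrs: "W = (n, rs)" by (cases W)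
  obtain cs u where cs: "distinct (concat cs)" "set (concat cs) = {..<n}" "[] \<notin> set cs"
    and u: "\<And>v. v < n \<Longrightarrow> u v \<in> words {..<n} \<and> u v \<noteq> []"
    and iso: "wirtinger_group (n, rs) \<cong> pres {..<n} (cyc_rels cs u)"
    using cyclic_form[OF W[unfolded nrs] euler[unfolded nrs]] by blast
  let ?A = "SIGMA v:{..<n}. {..<length (u v)}"
  obtain num where "bij_betw num ?A {0..<card ?A}"
    using ex_bij_betw_finite_nat[of ?A] by auto
  then interpret cyclic_presentation n cs u "card ?A" num
    using W cs u by unfold_locales (auto simp: nrs atLeast0LessThan)
  show thesis
    using that[OF is_gauss_diagram] iso_trans[OF iso diagram_group_iso] nrs by blast
qed

theorem theorem4p8:
  fixes G :: "('a, 'b) monoid_scheme"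
  assumes "group G"
  shows "virtual_link_group G \<longleftrightarrow>
    (\<exists>W. is_wirtinger W \<and> G \<cong> wirtinger_group W \<and>
      (\<forall>C \<in> components (wirtinger_graph W).
         euler_char (subgraph_on (wirtinger_graph W) C) \<in> {0, 1}))"
proof
  assume "virtual_link_group G"
  then obtain D where D: "is_gauss_diagram D" and G: "G \<cong> gauss_group D"
    by (auto simp: virtual_link_group_def)
  interpret gauss D by unfold_locales (rule D)
  show "\<exists>W. is_wirtinger W \<and> G \<cong> wirtinger_group W \<and>
      (\<forall>C \<in> components (wirtinger_graph W).
         euler_char (subgraph_on (wirtinger_graph W) C) \<in> {0, 1})"
    using wirtinger_of_gauss by (elim ex_forward conj_forward iso_trans[OF G])
next
  assume "\<exists>W. is_wirtinger W \<and> G \<cong> wirtinger_group W \<and>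
      (\<forall>C \<in> components (wirtinger_graph W).
         euler_char (subgraph_on (wirtinger_graph W) C) \<in> {0, 1})"
  then obtain W where W: "is_wirtinger W" and G: "G \<cong> wirtinger_group W"
    and euler: "\<And>C. C \<in> components (wirtinger_graph W) \<Longrightarrow>
      euler_char (subgraph_on (wirtinger_graph W) C) \<in> {0, 1}"
    by blast
  obtain D where "is_gauss_diagram D" "wirtinger_group W \<cong> gauss_group D"
    using gauss_of_wirtinger[OF W euler] .
  then show "virtual_link_group G"
    using iso_trans[OF G] unfolding virtual_link_group_def by blast
qed

end
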